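(* Fix an integer $n\ge2$. Let $x_1,\dots,x_m$ be pairwise coprime positive integers such that for each $j=1,\dots,m$ the number $(\sqrt[n]{x_j})^k$ is irrational for all positive integers $k<n$. Then the polynomial $p_n(z;x_1,\dots,x_m)$ in the single variable $z$ is irreducible over $\mathbb{Q}$.
   Context: $p_n(z;x_1,\dots,x_m)=\prod_{s_1,\dots,s_m=1}^n(\sqrt[n]{z}+\epsilon^{s_1}\sqrt[n]{x_1}+\dots+\epsilon^{s_m}\sqrt[n]{x_m})$, where $\epsilon$ is a primitive $n$-th root of unity; this is a polynomial in $z,x_1,\dots,x_m$ with integer coefficients. $\sqrt[n]{x_j}$ is the positive real root. *)

theory Defs
  imports
    Complex_Main
    "HOL-Library.FuncSet"
    "HOL-Computational_Algebra.Polynomial"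
    "HOL-Computational_Algebra.Fundamental_Theorem_Algebra"
    "HOL-Computational_Algebra.Polynomial_Factorial"
    "Jordan_Normal_Form.Determinant"
begin

definition primitive_unity_root :: "nat \<Rightarrow> complex \<Rightarrow> bool" where
  "primitive_unity_root n \<epsilon> \<longleftrightarrow> \<epsilon> ^ n = 1 \<and> (\<forall>k. 0 < k \<and> k < n \<longrightarrow> \<epsilon> ^ k \<noteq> 1)"

text \<open>The product below has an \<open>n\<close>-th root \<open>t\<close> of \<open>z\<close> in place of \<open>z\<close>. The factors are indexed by
  all tuples \<open>(s 1, \<dots>, s m)\<close> with entries in \<open>{1..n}\<close>.\<close>

definition root_product :: "nat \<Rightarrow> complex \<Rightarrow> nat \<Rightarrow> (nat \<Rightarrow> nat) \<Rightarrow> complex \<Rightarrow> complex" where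
  "root_product n \<epsilon> m x t =
     (\<Prod>s \<in> {1..m} \<rightarrow>\<^sub>E {1..n}. t + (\<Sum>j = 1..m. \<epsilon> ^ s j * of_real (root n (real (x j)))))"

text \<open>The polynomial \<open>p\<^sub>n(z; x\<^sub>1, \<dots>, x\<^sub>m)\<close> in the variable \<open>z\<close>. Its existence and uniqueness (for \<open>m \<ge> 1\<close>
  and positive \<open>x\<^sub>j\<close>) are shown in \<open>ex1_p_poly\<close>; for \<open>m = 0\<close> and \<open>n \<ge> 2\<close> there is no such
  polynomial, since the product is then just \<open>t\<close>.\<close>

definition p_poly :: "nat \<Rightarrow> complex \<Rightarrow> nat \<Rightarrow> (nat \<Rightarrow> nat) \<Rightarrow> int poly" where
  "p_poly n \<epsilon> m x =
     (THE q. \<forall>t. poly (map_poly of_int q) (t ^ n) = root_product n \<epsilon> m x t)"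

abbreviation cpoly :: "int poly \<Rightarrow> complex \<Rightarrow> complex" where
  "cpoly q \<equiv> poly (map_poly of_int q)"

lemma cpoly_add: "cpoly (p + q) t = cpoly p t + cpoly q t"
proof -
  have "map_poly of_int (p + q) = (map_poly of_int p + map_poly of_int q :: complex poly)"
    by (rule poly_eqI) (simp add: coeff_map_poly)
  thus ?thesis by simp
qed

lemma cpoly_pCons: "cpoly (pCons c q) t = of_int c + t * cpoly q t"
  by (simp add: map_poly_pCons)

lemma cpoly_smult: "cpoly (Polynomial.smult c q) t = of_int c * cpoly q t"
proof -
  have "map_poly of_int (Polynomial.smult c q) = (Polynomial.smult (of_int c) (map_poly of_int q) :: complex poly)"
    by (rule poly_eqI) (simp add: coeff_map_poly)
  thus ?thesis by simp
qed

lemma cpoly_mult: "cpoly (p * q) t = cpoly p t * cpoly q t"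
  by (induction p) (simp_all add: cpoly_add cpoly_smult cpoly_pCons algebra_simps mult_pCons_left
      del: map_poly_pCons)

lemma cpoly_0: "cpoly 0 t = 0" and cpoly_1: "cpoly 1 t = 1"
  by simp_all

lemma cpoly_hom: "comm_ring_hom (\<lambda>q. cpoly q t)"
  by unfold_locales (simp_all add: cpoly_add cpoly_mult)

text \<open>Multiplication by \<open>F(t + w)\<close> in the basis \<open>1, w, \<dots>, w ^ (n - 1)\<close>, where \<open>w ^ n = c\<close>.\<close>

lemma mult_matrix:
  fixes F :: "int poly"
  assumes n: "n > 0"
  shows "\<exists>a :: nat \<Rightarrow> nat \<Rightarrow> int poly. \<forall>t w. w ^ n = of_int c \<longrightarrow>
           (\<forall>j<n. (\<Sum>i<n. w ^ i * cpoly (a i j) t) = cpoly F (t + w) * w ^ j)"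
proof (induction F)
  case 0
  show ?case by (rule exI[of _ "\<lambda>_ _. 0"]) simp
next
  case (pCons b F)
  then obtain a :: "nat \<Rightarrow> nat \<Rightarrow> int poly" where a: "\<And>t w j. w ^ n = of_int c \<Longrightarrow> j < n \<Longrightarrow>
      (\<Sum>i<n. w ^ i * cpoly (a i j) t) = cpoly F (t + w) * w ^ j" by blast
  obtain k where k: "n = Suc k" using n by (cases n) auto
  define sh where "sh i j = (if i = 0 then Polynomial.smult c (a k j) else a (i - 1) j)" for i j
  define a' where "a' i j = (if i = j then [:b:] else 0) + (pCons 0 (a i j) + sh i j)" for i j
  have "(\<Sum>i<n. w ^ i * cpoly (a' i j) t) = cpoly (pCons b F) (t + w) * w ^ j"
    if w: "w ^ n = of_int c" and j: "j < n" for t w j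
  proof -
    have s: "(\<Sum>i<n. w ^ i * cpoly (sh i j) t) = w * (\<Sum>i<n. w ^ i * cpoly (a i j) t)"
    proof -
      have "(\<Sum>i<n. w ^ i * cpoly (sh i j) t)
          = of_int c * cpoly (a k j) t + (\<Sum>i<k. w ^ Suc i * cpoly (a i j) t)"
        unfolding k sum.lessThan_Suc_shift by (simp add: sh_def cpoly_smult)
      also have "\<dots> = w * (\<Sum>i<n. w ^ i * cpoly (a i j) t)"
        unfolding w[symmetric] k by (simp add: sum_distrib_left algebra_simps)
      finally show ?thesis .
    qed
    have "(\<Sum>i<n. w ^ i * cpoly (a' i j) t)
        = (\<Sum>i<n. (if i = j then w ^ i * of_int b else 0))
          + t * (\<Sum>i<n. w ^ i * cpoly (a i j) t) + (\<Sum>i<n. w ^ i * cpoly (sh i j) t)"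
      unfolding sum_distrib_left sum.distrib[symmetric]
      by (rule sum.cong)
         (simp_all add: a'_def cpoly_add cpoly_pCons algebra_simps del: map_poly_pCons)
    also have "(\<Sum>i<n. (if i = j then w ^ i * of_int b else 0)) = w ^ j * of_int b"
      using j by simp
    finally show ?thesis using s a[OF w j] by (simp add: cpoly_pCons algebra_simps)
  qed
  thus ?case by blast
qed

lemma primitive_unity_root_power_inj:
  assumes e: "primitive_unity_root n \<epsilon>" and "r < n" "s < n" "\<epsilon> ^ r = \<epsilon> ^ s"
  shows "r = s"
proof -
  have *: False if "a < b" "b < n" "\<epsilon> ^ a = \<epsilon> ^ b" for a b
  proof -
    have "\<epsilon> \<noteq> 0" using e that by (auto simp: primitive_unity_root_def power_0_left)
    moreover have "\<epsilon> ^ a * \<epsilon> ^ (b - a) = \<epsilon> ^ a * 1"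
      using that power_add[of \<epsilon> a "b - a"] by simp
    ultimately have "\<epsilon> ^ (b - a) = 1" by (metis mult_cancel_left power_not_zero)
    thus False using e that by (auto simp: primitive_unity_root_def)
  qed
  show ?thesis using assms(2-4) *[of r s] *[of s r] by (metis linorder_neqE_nat)
qed

lemma norm_shift:
  fixes F :: "int poly"
  assumes n: "n > 0" and e: "primitive_unity_root n \<epsilon>" and y: "y \<noteq> 0" "y ^ n = of_int c"
  shows "\<exists>Q. \<forall>t. cpoly Q t = (\<Prod>s = 1..n. cpoly F (t + \<epsilon> ^ s * y))"
proof -
  obtain a :: "nat \<Rightarrow> nat \<Rightarrow> int poly" where a: "\<And>t w j. w ^ n = of_int c \<Longrightarrow> j < n \<Longrightarrow>
      (\<Sum>i<n. w ^ i * cpoly (a i j) t) = cpoly F (t + w) * w ^ j"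
    using mult_matrix[OF n] by blast
  have en: "\<epsilon> ^ n = 1" using e by (simp add: primitive_unity_root_def)
  hence e0: "\<epsilon> \<noteq> 0" using n by (auto simp: power_0_left)
  define w where "w s = \<epsilon> ^ Suc s * y" for s
  have w0: "w s \<noteq> 0" for s using e0 y by (simp add: w_def)
  have wn: "w s ^ n = of_int c" for s
  proof -
    have "(\<epsilon> ^ Suc s) ^ n = (\<epsilon> ^ n) ^ Suc s" by (metis mult.commute power_mult)
    thus ?thesis using en y by (simp add: w_def power_mult_distrib)
  qed
  have winj: "r = s" if "r < n" "s < n" "w r = w s" for r s
    using primitive_unity_root_power_inj[OF e that(1,2)] that(3) y e0 by (simp add: w_def)
  define A where "A = mat n n (\<lambda>(i, j). a i j)"
  define V where "V = mat n n (\<lambda>(s, i). w s ^ i)"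
  define W where "W = mat n n (\<lambda>(i, r). inverse (w r) ^ i)"
  have A: "A \<in> carrier_mat n n" and V: "V \<in> carrier_mat n n" and W: "W \<in> carrier_mat n n"
    by (simp_all add: A_def V_def W_def)
  have VW: "V * W = of_nat n \<cdot>\<^sub>m 1\<^sub>m n"
  proof (rule eq_matI)
    fix s r assume "s < dim_row (of_nat n \<cdot>\<^sub>m 1\<^sub>m n :: complex mat)"
      "r < dim_col (of_nat n \<cdot>\<^sub>m 1\<^sub>m n :: complex mat)"
    hence sr: "s < n" "r < n" by simp_all
    have "(V * W) $$ (s, r) = (\<Sum>i<n. (w s / w r) ^ i)"
      using sr by (simp add: V_def W_def scalar_prod_def atLeast0LessThan divide_inverse
          power_mult_distrib)
    also have "\<dots> = (if s = r then of_nat n else 0)"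
    proof (cases "s = r")
      case True
      thus ?thesis using w0 by simp
    next
      case False
      hence "w s / w r \<noteq> 1" using winj[OF sr] w0 by auto
      moreover have "(w s / w r) ^ n = 1"
        using wn[of s] wn[of r] power_not_zero[OF w0[of r], of n] by (simp add: power_divide)
      ultimately show ?thesis using False by (simp only: sum_gp_strict if_False diff_self div_0)
    qed
    finally show "(V * W) $$ (s, r) = (of_nat n \<cdot>\<^sub>m 1\<^sub>m n) $$ (s, r)" using sr by simp
  qed (simp_all add: V_def W_def)
  have "det V * det W = of_nat n ^ n"
    using det_mult[OF V W] by (simp add: VW)
  hence dV: "det V \<noteq> 0" using n by auto
  have "cpoly (det A) t = (\<Prod>s = 1..n. cpoly F (t + \<epsilon> ^ s * y))" for t
  proof -
    define B where "B = map_mat (\<lambda>q. cpoly q t) A"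
    define D where "D = mat n n (\<lambda>(s, r). if s = r then cpoly F (t + w s) else 0)"
    have B: "B \<in> carrier_mat n n" and D: "D \<in> carrier_mat n n"
      using A by (simp_all add: B_def D_def)
    interpret comm_ring_hom "\<lambda>q. cpoly q t" by (rule cpoly_hom)
    have detB: "det B = cpoly (det A) t" unfolding B_def by (rule hom_det)
    have "V * B = D * V"
    proof (rule eq_matI)
      fix s j assume "s < dim_row (D * V)" "j < dim_col (D * V)"
      hence sj: "s < n" "j < n" by (simp_all add: D_def V_def)
      have "(V * B) $$ (s, j) = (\<Sum>i<n. w s ^ i * cpoly (a i j) t)"
        using sj by (simp add: V_def B_def A_def scalar_prod_def atLeast0LessThan)
      also have "\<dots> = cpoly F (t + w s) * w s ^ j" by (rule a[OF wn sj(2)])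
      also have "\<dots> = (\<Sum>r<n. (if s = r then cpoly F (t + w s) * w r ^ j else 0))"
        using sj by simp
      also have "\<dots> = (\<Sum>r<n. (if s = r then cpoly F (t + w s) else 0) * w r ^ j)"
        by (rule sum.cong) simp_all
      also have "\<dots> = (D * V) $$ (s, j)"
        using sj by (simp add: V_def D_def scalar_prod_def atLeast0LessThan)
      finally show "(V * B) $$ (s, j) = (D * V) $$ (s, j)" .
    qed (simp_all add: V_def D_def B_def A_def)
    hence "det V * det B = det D * det V"
      unfolding det_mult[OF V B, symmetric] det_mult[OF D V, symmetric] by (rule arg_cong)
    hence "det B = det D" using dV by (metis mult.commute mult_cancel_left)
    also have "det D = prod_list (diag_mat D)"
      by (rule det_upper_triangular[OF _ D]) (auto simp: D_def)
    also have "\<dots> = (\<Prod>s<n. cpoly F (t + w s))"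
      by (simp add: prod_list_diag_prod D_def atLeast0LessThan)
    also have "\<dots> = (\<Prod>s = 1..n. cpoly F (t + \<epsilon> ^ s * y))"
      unfolding w_def by (rule prod.reindex_bij_witness[of _ "\<lambda>s. s - 1" Suc]) auto
    finally show ?thesis by (simp add: detB)
  qed
  thus ?thesis by blast
qed

lemma root_product_Suc:
  "root_product n \<epsilon> (Suc m) x t =
     (\<Prod>s = 1..n. root_product n \<epsilon> m x (t + \<epsilon> ^ s * of_real (root n (real (x (Suc m))))))"
proof -
  let ?f = "\<lambda>k s. \<Sum>j = 1..k. \<epsilon> ^ s j * of_real (root n (real (x j)))"
  let ?P = "{1..m} \<rightarrow>\<^sub>E {1..n}"
  have ins: "{1..Suc m} = insert (Suc m) {1..m}" by auto
  have "root_product n \<epsilon> (Suc m) x t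
      = (\<Prod>p \<in> {1..n} \<times> ?P. t + ?f (Suc m) ((\<lambda>(y, g). g(Suc m := y)) p))"
    unfolding root_product_def ins PiE_insert_eq
    by (subst prod.reindex[OF inj_combinator]) (simp_all add: o_def ins)
  also have "\<dots> = (\<Prod>p \<in> {1..n} \<times> ?P.
      t + \<epsilon> ^ fst p * of_real (root n (real (x (Suc m)))) + ?f m (snd p))"
  proof (rule prod.cong)
    fix p :: "nat \<times> (nat \<Rightarrow> nat)"
    obtain y g where p: "p = (y, g)" by force
    have "?f m (g(Suc m := y)) = ?f m g" by (rule sum.cong) auto
    thus "t + ?f (Suc m) ((\<lambda>(y, g). g(Suc m := y)) p)
      = t + \<epsilon> ^ fst p * of_real (root n (real (x (Suc m)))) + ?f m (snd p)"
      by (simp add: p)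
  qed simp
  also have "\<dots> = (\<Prod>s = 1..n. root_product n \<epsilon> m x
      (t + \<epsilon> ^ s * of_real (root n (real (x (Suc m))))))"
    unfolding root_product_def prod.cartesian_product by (simp add: case_prod_beta)
  finally show ?thesis .
qed

lemma root_product_int_poly:
  assumes n: "n > 0" and e: "primitive_unity_root n \<epsilon>" and "\<forall>j\<in>{1..m}. x j > 0"
  shows "\<exists>F. \<forall>t. cpoly F t = root_product n \<epsilon> m x t"
  using assms(3)
proof (induction m)
  case 0
  show ?case by (rule exI[of _ "[:0, 1:]"]) (simp add: root_product_def map_poly_pCons)
next
  case (Suc m)
  then obtain F where F: "\<And>t. cpoly F t = root_product n \<epsilon> m x t" by auto
  let ?y = "of_real (root n (real (x (Suc m)))) :: complex"
  have x: "x (Suc m) > 0" using Suc.prems by simp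
  have "?y \<noteq> 0" using n x by simp
  moreover have "?y ^ n = of_int (int (x (Suc m)))"
    using n x by (simp flip: of_real_power)
  ultimately show ?case using norm_shift[OF n e, of ?y "int (x (Suc m))" F]
    by (simp add: root_product_Suc F)
qed

lemma root_product_rotate:
  assumes n: "n > 0" and m: "m > 0" and e: "\<epsilon> ^ n = 1"
  shows "root_product n \<epsilon> m x (\<epsilon> * t) = root_product n \<epsilon> m x t"
proof -
  let ?P = "{1..m} \<rightarrow>\<^sub>E {1..n}"
  let ?f = "\<lambda>s. \<Sum>j = 1..m. \<epsilon> ^ s j * of_real (root n (real (x j)))"
  define \<sigma> where "\<sigma> k = (if k = n then 1 else Suc k)" for k
  have \<sigma>_inj: "inj_on \<sigma> {1..n}"
  proof (rule inj_onI)
    fix a b assume ab: "a \<in> {1..n}" "b \<in> {1..n}" and eq: "\<sigma> a = \<sigma> b"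
    have ab': "a \<noteq> 0" "b \<noteq> 0" using ab by simp_all
    show "a = b"
      using ab' eq unfolding \<sigma>_def by (cases "a = n"; cases "b = n") simp_all
  qed
  define h where "h s = restrict (\<lambda>j. \<sigma> (s j)) {1..m}" for s :: "nat \<Rightarrow> nat"
  have fin: "finite ?P" by (rule finite_PiE) simp_all
  have \<sigma>_le: "\<sigma> k \<in> {1..n}" if "k \<in> {1..n}" for k
    using that n unfolding \<sigma>_def atLeastAtMost_iff by (cases "k = n") simp_all
  have sub: "h ` ?P \<subseteq> ?P"
  proof (rule image_subsetI)
    fix s assume s: "s \<in> ?P"
    show "h s \<in> ?P" unfolding h_def
      by (rule restrict_PiE_iff[THEN iffD2], rule ballI, rule \<sigma>_le, rule PiE_mem[OF s])
  qed
  have "inj_on h ?P"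
  proof (rule inj_onI)
    fix s s' assume s: "s \<in> ?P" "s' \<in> ?P" "h s = h s'"
    show "s = s'"
    proof (rule PiE_ext[OF s(1,2)])
      fix j assume j: "j \<in> {1..m}"
      have "\<sigma> (s j) = \<sigma> (s' j)"
        using fun_cong[OF s(3), of j] j by (simp only: h_def restrict_apply if_True)
      moreover have "s j \<in> {1..n}" "s' j \<in> {1..n}" using PiE_mem[OF s(1) j] PiE_mem[OF s(2) j] by simp_all
      ultimately show "s j = s' j" by (rule inj_onD[OF \<sigma>_inj])
    qed
  qed
  hence bij: "bij_betw h ?P ?P"
    using endo_inj_surj[OF fin sub] by (simp add: bij_betw_def)
  have es: "\<epsilon> ^ \<sigma> k = \<epsilon> * \<epsilon> ^ k" for k using e by (simp add: \<sigma>_def)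
  have fh: "?f (h s) = \<epsilon> * ?f s" for s
    unfolding sum_distrib_left by (rule sum.cong) (simp_all add: h_def es)
  have "root_product n \<epsilon> m x (\<epsilon> * t) = (\<Prod>s\<in>?P. \<epsilon> * t + ?f (h s))"
    unfolding root_product_def by (rule prod.reindex_bij_betw[OF bij, symmetric])
  also have "\<dots> = (\<Prod>s\<in>?P. \<epsilon> * (t + ?f s))"
    by (simp only: fh distrib_left)
  also have "\<dots> = \<epsilon> ^ card ?P * root_product n \<epsilon> m x t"
    by (simp add: prod.distrib root_product_def)
  also have "card ?P = n * n ^ (m - 1)"
    using m by (cases m) (simp_all add: card_PiE)
  also have "\<epsilon> ^ (n * n ^ (m - 1)) = 1" using e by (simp add: power_mult)
  finally show ?thesis by simp
qed

lemma cpoly_eq_sum: "degree p \<le> N \<Longrightarrow> cpoly p t = (\<Sum>i\<le>N. of_int (coeff p i) * t ^ i)"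
proof -
  assume N: "degree p \<le> N"
  have d: "degree (map_poly of_int p :: complex poly) = degree p"
    by (rule degree_map_poly) simp
  show ?thesis unfolding poly_altdef d coeff_map_poly[of of_int, simplified]
    using N by (intro sum.mono_neutral_left) (auto simp: coeff_eq_0)
qed

lemma rotation_invariant_poly:
  assumes n: "n > 0" and e: "primitive_unity_root n \<epsilon>"
    and inv: "\<And>t. cpoly F (\<epsilon> * t) = cpoly F t"
  shows "\<exists>q. \<forall>t. cpoly q (t ^ n) = cpoly F t"
proof -
  have "poly (map_poly of_int F \<circ>\<^sub>p [:0, \<epsilon>:]) = cpoly F"
    by (rule ext) (use inv in \<open>simp add: poly_pcompose mult.commute\<close>)
  hence pc: "map_poly of_int F \<circ>\<^sub>p [:0, \<epsilon>:] = map_poly of_int F"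
    by (simp add: poly_eq_poly_eq_iff)
  have zero: "coeff F k = 0" if k: "\<not> n dvd k" for k
  proof (rule ccontr)
    assume nz: "coeff F k \<noteq> 0"
    have "\<epsilon> ^ k * of_int (coeff F k) = (of_int (coeff F k) :: complex)"
      using arg_cong[OF pc, of "\<lambda>p. coeff p k"] by (simp add: coeff_pcompose_linear coeff_map_poly)
    hence "\<epsilon> ^ k = 1" using nz by simp
    moreover have "\<epsilon> ^ k = (\<epsilon> ^ n) ^ (k div n) * \<epsilon> ^ (k mod n)"
      by (simp only: power_mult[symmetric] power_add[symmetric] mult_div_mod_eq)
    ultimately have "\<epsilon> ^ (k mod n) = 1" using e by (simp add: primitive_unity_root_def)
    moreover have "0 < k mod n" "k mod n < n" using k n by (auto simp: mod_greater_zero_iff_not_dvd)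
    ultimately show False using e by (auto simp: primitive_unity_root_def)
  qed
  define d where "d = degree F"
  define q where "q = Poly (map (\<lambda>k. coeff F (n * k)) [0..<Suc d])"
  have cq: "coeff q k = coeff F (n * k)" if "k \<le> d" for k
    using that by (simp add: q_def coeff_Poly_eq nth_default_def del: upt_Suc)
  have dq: "degree q \<le> d"
    by (rule degree_le) (auto simp: q_def coeff_Poly_eq nth_default_def simp del: upt_Suc)
  have "cpoly q (t ^ n) = cpoly F t" for t
  proof -
    have z: "coeff F i = 0" if "i \<in> {..n * d} - (*) n ` {..d}" for i
    proof (rule zero, rule notI)
      assume "n dvd i"
      then obtain k where "i = n * k" by (rule dvdE)
      thus False using that n by auto
    qed
    have "cpoly F t = (\<Sum>i\<le>n * d. of_int (coeff F i) * t ^ i)"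
      by (rule cpoly_eq_sum) (use n in \<open>simp add: d_def\<close>)
    also have "\<dots> = (\<Sum>i\<in>(*) n ` {..d}. of_int (coeff F i) * t ^ i)"
      by (rule sum.mono_neutral_right) (use n z in auto)
    also have "\<dots> = (\<Sum>k\<le>d. of_int (coeff F (n * k)) * t ^ (n * k))"
      using n by (subst sum.reindex) (auto simp: inj_on_def)
    also have "\<dots> = cpoly q (t ^ n)"
      using cpoly_eq_sum[OF dq, of "t ^ n"] by (simp add: cq power_mult)
    finally show ?thesis by simp
  qed
  thus ?thesis by blast
qed

lemma ex1_p_poly:
  assumes n: "n > 0" and m: "m > 0" and e: "primitive_unity_root n \<epsilon>"
    and x: "\<forall>j\<in>{1..m}. x j > 0"
  shows "\<exists>!q. \<forall>t. poly (map_poly of_int q) (t ^ n) = root_product n \<epsilon> m x t"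
proof (rule ex_ex1I)
  obtain F where F: "\<And>t. cpoly F t = root_product n \<epsilon> m x t"
    using root_product_int_poly[OF n e x] by blast
  have "cpoly F (\<epsilon> * t) = cpoly F t" for t
    using root_product_rotate[OF n m] e by (simp add: F primitive_unity_root_def)
  from rotation_invariant_poly[OF n e this]
  show "\<exists>q. \<forall>t. cpoly q (t ^ n) = root_product n \<epsilon> m x t" by (simp add: F)
next
  fix q r
  assume q: "\<forall>t. cpoly q (t ^ n) = root_product n \<epsilon> m x t"
    and r: "\<forall>t. cpoly r (t ^ n) = root_product n \<epsilon> m x t"
  have "cpoly q z = cpoly r z" for z
  proof -
    have "rcis (root n (cmod z)) (Arg z / n) ^ n = z"
      using n by (simp add: DeMoivre2 rcis_cmod_Arg)
    thus ?thesis using q r by metis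
  qed
  hence "map_poly of_int q = (map_poly of_int r :: complex poly)"
    by (simp add: poly_eq_poly_eq_iff[symmetric] fun_eq_iff)
  thus "q = r" by (metis (mono_tags, lifting) coeff_map_poly of_int_0 of_int_eq_iff poly_eqI)
qed

lemma p_poly_eq:
  assumes "n > 0" "m > 0" "primitive_unity_root n \<epsilon>" "\<forall>j\<in>{1..m}. x j > 0"
  shows "poly (map_poly of_int (p_poly n \<epsilon> m x)) (t ^ n) = root_product n \<epsilon> m x t"
  using theI'[OF ex1_p_poly[OF assms]] by (simp add: p_poly_def)

end

(* Put r_j = x_j^(1/n) > 0 and F_j = Q(r_1, ..., r_j), a subfield of R. Each step F_j(r_{j+1}) has degree
   n: by a trace argument a positive b in F_j with b^n rational is a rational multiple of a monomial in
   r_1, ..., r_j, and coprimality together with the irrationality assumption keeps the powers r_{j+1}^k,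
   0 < k < n, from being of this form. Hence every choice of exponents s gives an embedding of F_m into C
   with r_j |-> eps^(s_j) r_j, so a rational polynomial vanishing at z_0 = (-(r_1 + ... + r_m))^n vanishes
   at every root of p_n. Taking real parts, r_1 + ... + r_m is different from all its other conjugates,
   so z_0 is a simple root of p_n. If now p_n = a b with a(z_0) = 0, then b(z_0) is nonzero; since all
   roots of p_n are conjugate to z_0, b has no root at all and is constant. *)

theory Submission
  imports Defs "Jordan_Normal_Form.Char_Poly"
begin

section \<open>Polynomials with coefficients in a subset, adjunction of an element, and roots of
  equal modulus\<close>

definition polys_over :: "'a::zero set \<Rightarrow> 'a poly set" where
  "polys_over F = {p. \<forall>i. coeff p i \<in> F}"

lemma polys_overI: "(\<And>i. coeff p i \<in> F) \<Longrightarrow> p \<in> polys_over F"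
  and polys_overD: "p \<in> polys_over F \<Longrightarrow> coeff p i \<in> F"
  by (auto simp: polys_over_def)

text \<open>Only polynomial expressions in \<open>r\<close> are taken, without quotients. Over a
  field they already form a field when \<open>r\<close> is algebraic; \<open>adjoin_subfield\<close>
  establishes this for radicals.\<close>

definition adjoin :: "'a::comm_semiring_0 set \<Rightarrow> 'a \<Rightarrow> 'a set" where
  "adjoin F r = {poly p r | p. p \<in> polys_over F}"

lemma adjoinI: "p \<in> polys_over F \<Longrightarrow> poly p r \<in> adjoin F r"
  by (auto simp: adjoin_def)

lemma adjoinE:
  assumes "a \<in> adjoin F r" obtains p where "p \<in> polys_over F" "a = poly p r"
  using assms by (auto simp: adjoin_def)

text \<open>Up to sign the constant coefficient is the product of the roots with multiplicity; the
  induction splits off one linear factor at a time.\<close>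

lemma norm_coeff_0_monic:
  fixes p :: "complex poly"
  assumes "lead_coeff p = 1" and "\<And>z. poly p z = 0 \<Longrightarrow> norm z = \<rho>"
  shows "norm (coeff p 0) = \<rho> ^ degree p"
  using assms
proof (induction "degree p" arbitrary: p)
  case 0
  thus ?case by simp
next
  case (Suc d)
  have "\<not> constant (poly p)" using Suc.hyps(2) by (simp add: constant_degree)
  then obtain z where z: "poly p z = 0" using fundamental_theorem_of_algebra by blast
  then obtain q where q: "p = [:-z, 1:] * q" by (auto simp: poly_eq_0_iff_dvd elim: dvdE)
  have "q \<noteq> 0" using q Suc.hyps(2) by auto
  hence d: "d = degree q" using Suc.hyps(2) q by (simp add: degree_mult_eq del: mult_pCons_left)
  have "lead_coeff q = 1"
    using Suc.prems(1) unfolding q lead_coeff_mult by simp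
  moreover have "norm y = \<rho>" if "poly q y = 0" for y
    using that Suc.prems(2)[of y] q by (simp del: mult_pCons_left)
  ultimately have "norm (coeff q 0) = \<rho> ^ degree q" using Suc.hyps(1)[OF d] by blast
  moreover have "norm z = \<rho>" using Suc.prems(2) z by blast
  moreover have "coeff p 0 = - z * coeff q 0" by (simp add: q)
  ultimately show ?case
    unfolding Suc.hyps(2)[symmetric] d by (simp only: norm_mult norm_minus_cancel power_Suc)
qed

section \<open>Real subfields and polynomials over them\<close>

text \<open>Subfields of the reals are taken inside the complex numbers, where their conjugates live.\<close>

locale real_subfield =
  fixes F :: "complex set"
  assumes subset_Reals: "F \<subseteq> \<real>"
    and one_mem: "1 \<in> F"
    and diff_mem: "a \<in> F \<Longrightarrow> b \<in> F \<Longrightarrow> a - b \<in> F"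
    and mult_mem: "a \<in> F \<Longrightarrow> b \<in> F \<Longrightarrow> a * b \<in> F"
    and inverse_mem: "a \<in> F \<Longrightarrow> inverse a \<in> F"
begin

lemma zero_mem: "0 \<in> F"
  using diff_mem[OF one_mem one_mem] by simp

lemma uminus_mem: "a \<in> F \<Longrightarrow> - a \<in> F"
  using diff_mem[OF zero_mem] by simp

lemma add_mem: "a \<in> F \<Longrightarrow> b \<in> F \<Longrightarrow> a + b \<in> F"
  using diff_mem[of a "- b"] uminus_mem by simp

lemma divide_mem: "a \<in> F \<Longrightarrow> b \<in> F \<Longrightarrow> a / b \<in> F"
  by (simp add: divide_inverse mult_mem inverse_mem)

lemma power_mem: "a \<in> F \<Longrightarrow> a ^ k \<in> F"
  by (induction k) (auto intro: one_mem mult_mem)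

lemma sum_mem: "(\<And>i. i \<in> I \<Longrightarrow> f i \<in> F) \<Longrightarrow> sum f I \<in> F"
  by (induction I rule: infinite_finite_induct) (auto intro: zero_mem add_mem)

lemma of_nat_mem: "of_nat k \<in> F"
  by (induction k) (auto intro: zero_mem one_mem add_mem)

lemma Rats_subset: "\<rat> \<subseteq> F"
proof
  fix a :: complex assume "a \<in> \<rat>"
  then obtain i j where a: "a = of_int i / of_int j" by (auto elim: Rats_cases')
  have "of_int k \<in> F" for k :: int
    by (cases k) (auto intro: of_nat_mem uminus_mem diff_mem one_mem simp del: of_nat_Suc)
  thus "a \<in> F" unfolding a by (intro divide_mem)
qed

lemma polys_over_simps:
  "0 \<in> polys_over F"
  "p \<in> polys_over F \<Longrightarrow> q \<in> polys_over F \<Longrightarrow> p + q \<in> polys_over F"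
  "p \<in> polys_over F \<Longrightarrow> q \<in> polys_over F \<Longrightarrow> p - q \<in> polys_over F"
  "p \<in> polys_over F \<Longrightarrow> q \<in> polys_over F \<Longrightarrow> p * q \<in> polys_over F"
  "a \<in> F \<Longrightarrow> p \<in> polys_over F \<Longrightarrow> Polynomial.smult a p \<in> polys_over F"
  "a \<in> F \<Longrightarrow> p \<in> polys_over F \<Longrightarrow> pCons a p \<in> polys_over F"
  "a \<in> F \<Longrightarrow> monom a k \<in> polys_over F"
  by (auto simp: polys_over_def coeff_mult coeff_pCons split: nat.splits
      intro!: zero_mem add_mem diff_mem mult_mem sum_mem)

lemma polys_over_power: "p \<in> polys_over F \<Longrightarrow> p ^ k \<in> polys_over F"
  by (induction k) (auto simp: one_pCons intro!: polys_over_simps one_mem)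

lemma polys_over_sum: "(\<And>i. i \<in> I \<Longrightarrow> f i \<in> polys_over F) \<Longrightarrow> sum f I \<in> polys_over F"
  by (induction I rule: infinite_finite_induct) (auto intro: polys_over_simps)

text \<open>The point is that quotient and remainder keep their coefficients in \<open>F\<close>.
  The induction takes one coefficient of \<open>f\<close> at a time: the old remainder is multiplied
  by X, and a multiple of \<open>p\<close> removes the term of degree \<open>degree p\<close> that
  may arise.\<close>

lemma monic_division:
  assumes p: "p \<in> polys_over F" "lead_coeff p = 1" and "f \<in> polys_over F"
  shows "\<exists>q\<in>polys_over F. \<exists>g\<in>polys_over F. f = p * q + g \<and> (g = 0 \<or> degree g < degree p)"
  using assms(3)
proof (induction f)
  case 0
  show ?case by (intro bexI[of _ 0]) (auto intro: polys_over_simps)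
next
  case (pCons a f)
  have a: "a \<in> F" and "f \<in> polys_over F"
    using polys_overD[OF pCons.prems, of 0] polys_overD[OF pCons.prems, of "Suc i" for i]
    by (auto intro: polys_overI)
  then obtain q g where q: "q \<in> polys_over F" and g: "g \<in> polys_over F"
    and f: "f = p * q + g" and deg: "g = 0 \<or> degree g < degree p"
    using pCons.IH by blast
  define c where "c = coeff (pCons a g) (degree p)"
  define g' where "g' = pCons a g - Polynomial.smult c p"
  have c: "c \<in> F" unfolding c_def by (rule polys_overD) (intro polys_over_simps a g)
  have "degree (pCons a g) \<le> degree p" using deg by (auto simp: degree_pCons_eq_if)
  hence "degree g' \<le> degree p" unfolding g'_def by (intro degree_diff_le) (auto intro: degree_smult_le)
  moreover have "coeff g' (degree p) = 0" using p(2) by (simp add: g'_def c_def)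
  ultimately have "g' = 0 \<or> degree g' < degree p" by (metis eq_zero_or_degree_less)
  moreover have "pCons a f = p * pCons c q + g'"
    by (simp add: f g'_def mult_pCons_right)
  moreover have "pCons c q \<in> polys_over F" "g' \<in> polys_over F"
    unfolding g'_def by (intro polys_over_simps a c q g p)+
  ultimately show ?case by blast
qed

lemma monic_normalize:
  assumes "p \<in> polys_over F" "p \<noteq> 0"
  shows "Polynomial.smult (inverse (lead_coeff p)) p \<in> polys_over F"
    and "lead_coeff (Polynomial.smult (inverse (lead_coeff p)) p) = 1"
  using assms by (auto intro!: polys_over_simps inverse_mem polys_overD)

lemma subset_adjoin: "F \<subseteq> adjoin F r"
proof
  fix a assume "a \<in> F"
  thus "a \<in> adjoin F r" using adjoinI[of "[:a:]" F r] by (auto intro: polys_over_simps)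
qed

lemma gen_mem_adjoin: "r \<in> adjoin F r"
  using adjoinI[of "[:0, 1:]" F r] by (auto intro!: polys_over_simps zero_mem one_mem)

end

section \<open>Adjoining a real radical\<close>

text \<open>With \<open>r > 0\<close> and \<open>F\<close> real, excluding the lower powers makes
  X^n - r^n the minimal polynomial of \<open>r\<close> over \<open>F\<close>;
  \<open>small_annihilator_eq_0\<close> proves this.\<close>

locale radical_extension = real_subfield +
  fixes r :: real and n :: nat
  assumes r_pos: "r > 0" and n_pos: "n > 0"
    and power_in: "complex_of_real r ^ n \<in> F"
    and power_notin: "0 < k \<Longrightarrow> k < n \<Longrightarrow> complex_of_real r ^ k \<notin> F"
begin

definition radical_poly :: "complex poly" where
  "radical_poly = monom 1 n - [:complex_of_real r ^ n:]"

lemma radical_poly: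
  "radical_poly \<in> polys_over F" "degree radical_poly = n" "lead_coeff radical_poly = 1"
  "poly radical_poly y = y ^ n - of_real r ^ n"
proof -
  show "radical_poly \<in> polys_over F"
    unfolding radical_poly_def by (intro polys_over_simps one_mem power_in)
  show d: "degree radical_poly = n"
  proof (rule antisym)
    show "degree radical_poly \<le> n" unfolding radical_poly_def
      by (rule degree_diff_le) (auto simp: degree_monom_le)
    show "n \<le> degree radical_poly" unfolding radical_poly_def
      by (rule le_degree) (use n_pos in \<open>auto simp: coeff_pCons split: nat.splits\<close>)
  qed
  show "lead_coeff radical_poly = 1" unfolding d using n_pos
    by (auto simp: radical_poly_def coeff_pCons split: nat.splits)
  show "poly radical_poly y = y ^ n - of_real r ^ n"
    by (simp add: radical_poly_def poly_monom)
qed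

lemma small_annihilator_eq_0:
  assumes "g \<in> polys_over F" "poly g r = 0" "degree g < n"
  shows "g = 0"
proof (rule ccontr)
  assume "g \<noteq> 0"
  define P where "P p \<longleftrightarrow> p \<in> polys_over F \<and> p \<noteq> 0 \<and> poly p r = 0" for p
  have "P g" using assms \<open>g \<noteq> 0\<close> by (simp add: P_def)
  then obtain p where p: "P p" and min: "\<And>p'. P p' \<Longrightarrow> degree p \<le> degree p'"
    using ex_has_least_nat[of P g degree] by blast
  \<comment> \<open>All roots of the minimal polynomial \<open>p1\<close> of \<open>r\<close> have modulus \<open>r\<close>, so its constant coefficient
    puts \<open>r ^ degree p1\<close> into the real field \<open>F\<close>.\<close>
  define p1 where "p1 = Polynomial.smult (inverse (lead_coeff p)) p"
  have p1: "p1 \<in> polys_over F" "lead_coeff p1 = 1"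
    using p unfolding p1_def P_def by (blast intro: monic_normalize)+
  have p1': "degree p1 = degree p" "poly p1 r = 0" using p by (auto simp: P_def p1_def)
  obtain q s where qs: "q \<in> polys_over F" "s \<in> polys_over F" "radical_poly = p1 * q + s"
    "s = 0 \<or> degree s < degree p1"
    using monic_division[OF p1 radical_poly(1)] by blast
  have "poly s r = 0"
    using arg_cong[OF qs(3), of "\<lambda>p. poly p r"] p1'(2) by (simp add: radical_poly)
  hence "s = 0" using min[of s] qs(2,4) p1'(1) unfolding P_def by linarith
  have "norm y = r" if "poly p1 y = 0" for y
  proof -
    have "y ^ n = of_real r ^ n"
      using arg_cong[OF qs(3), of "\<lambda>p. poly p y"] that \<open>s = 0\<close> by (simp add: radical_poly)
    hence "norm y ^ n = r ^ n" using r_pos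
      by (metis abs_of_pos norm_of_real norm_power)
    thus ?thesis using power_eq_imp_eq_base[of "norm y" n r] n_pos r_pos by simp
  qed
  hence "norm (coeff p1 0) = r ^ degree p1" by (rule norm_coeff_0_monic[OF p1(2)])
  hence "complex_of_real r ^ degree p1 = of_real (norm (coeff p1 0))" by simp
  also have "coeff p1 0 \<in> F" by (rule polys_overD[OF p1(1)])
  \<comment> \<open>An element of \<open>F\<close> is real, so its modulus is the element or its
    negative and stays in \<open>F\<close>.\<close>
  hence "of_real (norm (coeff p1 0)) \<in> F"
    using subset_Reals uminus_mem by (auto elim!: Reals_cases simp: abs_if)
  finally have "complex_of_real r ^ degree p1 \<in> F" .
  moreover have "degree p1 < n" using min[OF \<open>P g\<close>] assms(3) p1' by simp
  moreover have "degree p1 \<noteq> 0"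
  proof
    assume "degree p1 = 0"
    hence "p1 = 1" using p1(2) by (auto elim: degree_eq_zeroE)
    thus False using p1' by simp
  qed
  ultimately show False using power_notin by blast
qed

lemma reduce:
  assumes "f \<in> polys_over F"
  obtains q g where "q \<in> polys_over F" "g \<in> polys_over F" "f = radical_poly * q + g" "degree g < n"
  using monic_division[OF radical_poly(1,3) assms] n_pos unfolding radical_poly(2) by force

lemma annihilator:
  assumes "f \<in> polys_over F" "poly f r = 0"
  obtains q where "q \<in> polys_over F" "f = radical_poly * q"
proof -
  obtain q g where qg: "q \<in> polys_over F" "g \<in> polys_over F" "f = radical_poly * q + g" "degree g < n"
    using reduce[OF assms(1)] .
  have "poly g r = 0" using assms(2) by (simp add: qg(3) radical_poly)
  hence "g = 0" using small_annihilator_eq_0 qg by blast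
  thus thesis using qg that by simp
qed

lemma adjoin_reduced:
  assumes "a \<in> adjoin F r"
  obtains p where "p \<in> polys_over F" "degree p < n" "a = poly p r"
proof -
  obtain f where f: "f \<in> polys_over F" "a = poly f r" using assms by (rule adjoinE)
  obtain q g where "q \<in> polys_over F" "g \<in> polys_over F" "f = radical_poly * q + g" "degree g < n"
    using reduce[OF f(1)] .
  thus thesis using that[of g] f by (simp add: radical_poly)
qed

text \<open>Dividing \<open>radical_poly\<close> by the monic multiple \<open>p1\<close> of
  \<open>p\<close> leaves a remainder \<open>s\<close> with s(r) = - p1(r) q(r). The inverse of
  s(r), available by induction on the degree, yields that of p(r).\<close>

lemma inverse_mem_adjoin:
  assumes "p \<in> polys_over F" "degree p < n" "poly p r \<noteq> 0"
  shows "inverse (poly p r) \<in> adjoin F r"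
  using assms
proof (induction "degree p" arbitrary: p rule: less_induct)
  case less
  define c where "c = lead_coeff p"
  have p0: "p \<noteq> 0" using less.prems by auto
  have c: "c \<in> F" "c \<noteq> 0" unfolding c_def using less.prems p0 by (auto intro: polys_overD)
  define p1 where "p1 = Polynomial.smult (inverse c) p"
  have p1: "p1 \<in> polys_over F" "lead_coeff p1 = 1"
    unfolding p1_def c_def using less.prems(1) p0 by (blast intro: monic_normalize)+
  have deg: "degree p1 = degree p" using c by (simp add: p1_def)
  have p: "poly p r = c * poly p1 r" using c by (simp add: p1_def)
  show ?case
  proof (cases "degree p = 0")
    case True
    hence "p1 = 1" using p1(2) deg by (auto elim: degree_eq_zeroE)
    thus ?thesis using subset_adjoin inverse_mem c by (auto simp: p)
  next
    case False
    obtain q s where qs: "q \<in> polys_over F" "s \<in> polys_over F" "radical_poly = p1 * q + s"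
      "s = 0 \<or> degree s < degree p1"
      using monic_division[OF p1 radical_poly(1)] by blast
    have eval: "poly s r = - (poly p1 r * poly q r)"
      using arg_cong[OF qs(3), of "\<lambda>p. poly p r"] by (simp add: radical_poly eq_neg_iff_add_eq_0 add.commute)
    \<comment> \<open>If \<open>s\<close> vanished at \<open>r\<close>, it would be zero, and
      \<open>q\<close>, of degree below \<open>n\<close>, would annihilate \<open>r\<close>.\<close>
    have s0: "poly s r \<noteq> 0"
    proof
      assume s: "poly s r = 0"
      have "degree s < n" using qs(4) deg less.prems(2) n_pos by auto
      hence "s = 0" using small_annihilator_eq_0 qs(2) s by blast
      have q0: "q \<noteq> 0" using qs(3) \<open>s = 0\<close> radical_poly(2) n_pos by auto
      have "n = degree p1 + degree q"
        using radical_poly(2) qs(3) \<open>s = 0\<close> q0 p1 by (metis add_0_right degree_mult_eq leading_coeff_0_iff zero_neq_one)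
      hence "degree q < n" using False deg by simp
      moreover have "poly q r = 0" using eval s less.prems(3) by (auto simp: p)
      ultimately show False using small_annihilator_eq_0 qs(1) q0 by blast
    qed
    hence "degree s < degree p" using qs(4) deg by auto
    then have "inverse (poly s r) \<in> adjoin F r"
      using less.hyps[of s] qs(2) s0 less.prems(2) by simp
    then obtain u where u: "u \<in> polys_over F" "inverse (poly s r) = poly u r" by (rule adjoinE)
    define v where "v = Polynomial.smult (- inverse c) (q * u)"
    have "v \<in> polys_over F" unfolding v_def by (intro polys_over_simps qs u uminus_mem inverse_mem c)
    moreover have "inverse (poly p r) = poly v r"
      using s0 c unfolding v_def p eval by (simp add: u(2)[symmetric] eval field_simps)
    ultimately show ?thesis using adjoinI by simp
  qed
qed

lemma adjoin_subfield: "real_subfield (adjoin F r)"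
proof
  show "adjoin F r \<subseteq> \<real>"
  proof
    fix a assume "a \<in> adjoin F r"
    then obtain p where p: "p \<in> polys_over F" "a = poly p r" by (rule adjoinE)
    show "a \<in> \<real>" unfolding p poly_altdef
      using polys_overD[OF p(1)] subset_Reals by (intro sum_in_Reals Reals_mult Reals_power) auto
  qed
  show "1 \<in> adjoin F r" using subset_adjoin one_mem by blast
next
  fix a b assume "a \<in> adjoin F r" "b \<in> adjoin F r"
  then obtain p q where *: "p \<in> polys_over F" "a = poly p r" "q \<in> polys_over F" "b = poly q r"
    by (meson adjoinE)
  show "a - b \<in> adjoin F r" using adjoinI[of "p - q" F r] * polys_over_simps by simp
  show "a * b \<in> adjoin F r" using adjoinI[of "p * q" F r] * polys_over_simps by simp
next
  fix a assume "a \<in> adjoin F r"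
  then obtain p where "p \<in> polys_over F" "degree p < n" "a = poly p r" by (rule adjoin_reduced)
  thus "inverse a \<in> adjoin F r"
    using inverse_mem_adjoin subset_adjoin zero_mem by (cases "a = 0") auto
qed


text \<open>Every relation of \<open>r\<close> over \<open>F\<close> is a multiple of
  \<open>radical_poly\<close>, which vanishes at \<open>y\<close> too.\<close>

lemma conjugate_root:
  assumes "f \<in> polys_over F" "poly f r = 0" "y ^ n = of_real r ^ n"
  shows "poly f y = 0"
proof -
  obtain q where "f = radical_poly * q" using annihilator[OF assms(1,2)] .
  thus ?thesis using assms(3) by (simp add: radical_poly)
qed

end

section \<open>Traces in a radical extension\<close>

lemma sum_powers_unity_root:
  assumes "primitive_unity_root n \<epsilon>"
  shows "(\<Sum>s<n. (\<epsilon> ^ s) ^ i) = (if n dvd i then of_nat n else 0)"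
proof -
  have e: "\<epsilon> ^ n = 1" using assms by (simp add: primitive_unity_root_def)
  have eq: "(\<epsilon> ^ s) ^ i = (\<epsilon> ^ i) ^ s" for s by (metis mult.commute power_mult)
  show ?thesis
  proof (cases "n dvd i")
    case True
    hence "\<epsilon> ^ i = 1" using e by (auto simp: power_mult elim!: dvdE)
    thus ?thesis using True by (simp add: eq)
  next
    case False
    have "\<epsilon> ^ i = \<epsilon> ^ (n * (i div n) + i mod n)" by simp
    also have "\<dots> = \<epsilon> ^ (i mod n)" by (simp only: power_add power_mult e) simp
    finally have ei: "\<epsilon> ^ i = \<epsilon> ^ (i mod n)" .
    show ?thesis
    proof (cases "n = 0")
      case n: False
      hence "0 < i mod n" "i mod n < n" using False by (auto simp: mod_greater_zero_iff_not_dvd)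
      hence "\<epsilon> ^ i \<noteq> 1" using assms ei by (auto simp: primitive_unity_root_def)
      moreover have "(\<epsilon> ^ i) ^ n = 1" using e by (metis mult.commute power_mult power_one)
      ultimately show ?thesis using False by (simp add: eq sum_gp_strict)
    qed simp
  qed
qed

context radical_extension
begin

text \<open>This sum is a trace: only exponents divisible by \<open>n\<close> survive the summation
  over the roots of unity, and those powers of \<open>r\<close> lie in \<open>F\<close>.\<close>

lemma conjugate_sum:
  assumes e: "primitive_unity_root n \<epsilon>" and h: "h \<in> polys_over F"
  shows "(\<Sum>s<n. poly h (\<epsilon> ^ s * r)) \<in> F"
proof -
  have "(\<Sum>s<n. poly h (\<epsilon> ^ s * r))
      = (\<Sum>i\<le>degree h. coeff h i * (of_real r ^ i * (\<Sum>s<n. (\<epsilon> ^ s) ^ i)))"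
    unfolding poly_altdef sum_distrib_left
    by (subst sum.swap) (simp add: power_mult_distrib algebra_simps)
  also have "\<dots> \<in> F"
  proof (intro sum_mem mult_mem[OF polys_overD[OF h]])
    fix i
    show "of_real r ^ i * (\<Sum>s<n. (\<epsilon> ^ s) ^ i) \<in> F"
    proof (cases "n dvd i")
      case True
      then obtain k where "i = n * k" by (rule dvdE)
      hence "complex_of_real r ^ i \<in> F" using power_mem[OF power_in, of k] by (simp add: power_mult)
      thus ?thesis using True by (simp add: sum_powers_unity_root[OF e] mult_mem of_nat_mem)
    qed (simp add: sum_powers_unity_root[OF e] zero_mem)
  qed
  finally show ?thesis .
qed

text \<open>Discrete Fourier inversion: for exponents \<open>i\<close> and \<open>k\<close> below
  \<open>n\<close>, the difference i - k is divisible by \<open>n\<close> only if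
  \<open>i = k\<close>.\<close>

lemma coeff_as_conjugate_sum:
  assumes e: "primitive_unity_root n \<epsilon>" and p: "degree p < n" and k: "k < n"
  shows "(\<Sum>s<n. poly p (\<epsilon> ^ s * r) / (\<epsilon> ^ s * r) ^ k) = of_nat n * coeff p k"
proof -
  have en: "\<epsilon> ^ n = 1" using e by (simp add: primitive_unity_root_def)
  hence e0: "\<epsilon> \<noteq> 0" using n_pos by (auto simp: power_0_left)
  define y where "y s = \<epsilon> ^ s * complex_of_real r" for s
  have y0: "y s \<noteq> 0" for s using e0 r_pos by (simp add: y_def)
  have S: "(\<Sum>s<n. y s ^ i / y s ^ k) = (if i = k then of_nat n else 0)" if i: "i < n" for i
  proof -
    \<comment> \<open>The exponent i - k, shifted by \<open>n\<close> so that it is a natural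
      number.\<close>
    define j where "j = i + (n - k)"
    have "y s ^ i / y s ^ k = (\<epsilon> ^ s) ^ j * (of_real r ^ i / of_real r ^ k)" for s
    proof -
      have "(\<epsilon> ^ s) ^ k * (\<epsilon> ^ s) ^ (n - k) = (\<epsilon> ^ s) ^ n"
        using k by (simp flip: power_add)
      also have "\<dots> = 1" using en by (metis mult.commute power_mult power_one)
      finally have "(\<epsilon> ^ s) ^ (n - k) = 1 / (\<epsilon> ^ s) ^ k" using e0 by (simp add: field_simps)
      thus ?thesis by (simp add: y_def j_def power_mult_distrib power_add)
    qed
    hence "(\<Sum>s<n. y s ^ i / y s ^ k)
        = (if n dvd j then of_nat n else 0) * (of_real r ^ i / of_real r ^ k)"
      by (simp add: sum_powers_unity_root[OF e, symmetric] sum_distrib_right sum_divide_distrib)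
    moreover have "n dvd j \<longleftrightarrow> i = k"
    proof
      assume "n dvd j"
      then obtain c where c: "j = n * c" by (rule dvdE)
      have "0 < j" "j < n * 2" using i k unfolding j_def by linarith+
      hence "c = 1" using c n_pos by (cases c) (auto simp del: mult_2_right)
      thus "i = k" using c i k by (simp add: j_def)
    qed (use k in \<open>simp add: j_def\<close>)
    ultimately show ?thesis using r_pos by simp
  qed
  have "(\<Sum>s<n. poly p (y s) / y s ^ k) = (\<Sum>s<n. \<Sum>i\<le>degree p. coeff p i * (y s ^ i / y s ^ k))"
    by (simp add: poly_altdef sum_divide_distrib)
  also have "\<dots> = (\<Sum>i\<le>degree p. coeff p i * (\<Sum>s<n. y s ^ i / y s ^ k))"
    unfolding sum_distrib_left by (rule sum.swap)
  also have "\<dots> = (\<Sum>i\<le>degree p. if i = k then of_nat n * coeff p k else 0)"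
    by (rule sum.cong) (use p S in auto)
  also have "\<dots> = of_nat n * coeff p k"
    by (auto simp: coeff_eq_0)
  finally show ?thesis by (simp add: y_def)
qed

lemma radical_in_adjoin:
  fixes b :: real
  assumes e: "primitive_unity_root n \<epsilon>"
    and b: "b > 0" "complex_of_real b \<in> adjoin F r" "complex_of_real b ^ n \<in> F"
  shows "\<exists>k<n. complex_of_real (b / r ^ k) \<in> F"
proof -
  obtain p where p: "p \<in> polys_over F" "degree p < n" "of_real b = poly p r"
    using adjoin_reduced[OF b(2)] .
  have "p \<noteq> 0" using p b(1) by auto
  \<comment> \<open>Any exponent at which \<open>p\<close> has a nonzero coefficient would serve:
    \<open>n * coeff p k\<close> will be the trace of \<open>b / r ^ k\<close>.\<close>
  define k where "k = degree p"
  have k: "k < n" "coeff p k \<noteq> 0" using p \<open>p \<noteq> 0\<close> by (auto simp: k_def)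
  define w where "w = b / r ^ k"
  have w_pos: "w > 0" using b r_pos by (simp add: w_def)
  have "complex_of_real w ^ n = complex_of_real b ^ n / (complex_of_real r ^ n) ^ k"
    by (simp add: w_def power_divide mult.commute flip: power_mult)
  also have "\<dots> \<in> F" by (intro divide_mem power_mem b power_in)
  finally have wn: "complex_of_real w ^ n \<in> F" .
  have "complex_of_real w \<in> F"
  proof (rule ccontr)
    assume w: "complex_of_real w \<notin> F"
    \<comment> \<open>Minimality of \<open>d\<close> makes \<open>w\<close> a radical of exponent
      \<open>d\<close> over \<open>F\<close>, so that \<open>small_annihilator_eq_0\<close> also
      applies to \<open>w\<close>.\<close>
    define d where "d = (LEAST d. 0 < d \<and> complex_of_real w ^ d \<in> F)"
    have d: "0 < d \<and> complex_of_real w ^ d \<in> F"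
      unfolding d_def by (rule LeastI[of _ n]) (use n_pos wn in simp)
    have "complex_of_real w ^ i \<notin> F" if "0 < i" "i < d" for i
      using not_less_Least[of i "\<lambda>d. 0 < d \<and> complex_of_real w ^ d \<in> F"] that
      unfolding d_def by blast
    then interpret w: radical_extension F w d
      using w_pos d by unfold_locales auto
    have "d \<noteq> 1" using w d by auto
    hence d2: "2 \<le> d" using d by linarith
    have en: "\<epsilon> ^ n = 1" using e by (simp add: primitive_unity_root_def)
    hence e0: "\<epsilon> \<noteq> 0" using n_pos by (auto simp: power_0_left)
    define y where "y s = \<epsilon> ^ s * complex_of_real r" for s
    have y0: "y s \<noteq> 0" for s using e0 r_pos by (simp add: y_def)
    have yn: "y s ^ n = of_real r ^ n" for s
    proof -
      have "(\<epsilon> ^ s) ^ n = 1" using en by (metis mult.commute power_mult power_one)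
      thus ?thesis by (simp add: y_def power_mult_distrib)
    qed
    \<comment> \<open>The image of w = p(r) / r^k when \<open>r\<close> is replaced by its conjugate
      \<open>y s\<close>.\<close>
    define v where "v s = poly p (y s) / y s ^ k" for s
    define t where "t i = (\<Sum>s<n. v s ^ i)" for i
    have v_power: "v s ^ d = of_real w ^ d" for s
    proof -
      \<comment> \<open>The equation b^d = w^d r^(kd), written as a polynomial relation of
        \<open>r\<close> so that it passes to \<open>y s\<close>.\<close>
      define f where "f = p ^ d - monom (of_real w ^ d) (k * d)"
      have "f \<in> polys_over F"
        unfolding f_def using d by (intro polys_over_simps polys_over_power p) auto
      moreover have "poly f r = 0"
        using r_pos by (simp add: f_def poly_monom p(3)[symmetric] w_def power_divide power_mult)
      ultimately have "poly f (y s) = 0" using conjugate_root yn by blast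
      thus ?thesis using y0 by (simp add: f_def v_def poly_monom power_divide divide_eq_eq power_mult[of "y s" k d])
    qed
    have t_mem: "t i \<in> F" for i
    proof -
      \<comment> \<open>The negative powers of \<open>y s\<close> in \<open>v s ^ i\<close> are
        cleared by the factor (r^n)^(ki), which equals the same power of \<open>y s ^ n\<close>,
        lies in \<open>F\<close> and does not depend on \<open>s\<close>.\<close>
      define h where "h = p ^ i * monom 1 (k * i * (n - 1))"
      have "v s ^ i = poly h (y s) / (of_real r ^ n) ^ (k * i)" for s
      proof -
        have "(of_real r ^ n) ^ (k * i) = y s ^ (k * i * (n - 1)) * y s ^ (k * i)"
          unfolding yn[of s, symmetric] using n_pos
          by (simp flip: power_mult power_add) (simp add: algebra_simps)
        thus ?thesis using y0 by (simp add: h_def v_def poly_monom power_divide power_mult)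
      qed
      hence "t i = (\<Sum>s<n. poly h (y s)) / (of_real r ^ n) ^ (k * i)"
        by (simp add: t_def sum_divide_distrib)
      moreover have "h \<in> polys_over F" unfolding h_def
        by (intro polys_over_simps polys_over_power p one_mem)
      hence "(\<Sum>s<n. poly h (y s)) \<in> F" unfolding y_def by (rule conjugate_sum[OF e])
      ultimately show ?thesis using power_in by (auto intro: divide_mem power_mem)
    qed
    have t1: "t 1 = of_nat n * coeff p k"
      using coeff_as_conjugate_sum[OF e p(2) k(1)] by (simp add: t_def v_def y_def)
    \<comment> \<open>The \<open>t i\<close> are the traces of the powers of \<open>w\<close>. As the conjugates \<open>v s\<close> of \<open>w\<close> are roots of
      \<open>X ^ d - w ^ d\<close>, the polynomial \<open>\<Sum> t i * X ^ (d - 1 - i)\<close> takes the value \<open>N * d * w ^ (d - 1)\<close> at \<open>w\<close>,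
      where \<open>N\<close> counts the \<open>s\<close> with \<open>v s = w\<close>. Independence of the powers of \<open>w\<close> over \<open>F\<close> makes
      this an identity of coefficients, so the trace \<open>t 1\<close> of \<open>w\<close> vanishes.\<close>
    define N where "N = card {s. s < n \<and> v s = of_real w}"
    define L where "L = (\<Sum>i<d. monom (t i) (d - Suc i)) - monom (of_nat (N * d)) (d - 1)"
    have "L \<in> polys_over F" unfolding L_def
      by (intro polys_over_simps polys_over_sum t_mem of_nat_mem)
    moreover have "degree L < d"
    proof -
      have "degree L \<le> d - 1" unfolding L_def
        by (intro degree_diff_le degree_sum_le order_trans[OF degree_monom_le]) auto
      thus ?thesis using d2 by linarith
    qed
    moreover have "poly L w = 0"
    proof -
      have geo: "(\<Sum>i<d. v s ^ i * of_real w ^ (d - Suc i))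
          = (if v s = of_real w then of_nat d * of_real w ^ (d - 1) else 0)" for s
      proof (cases "v s = of_real w")
        case True
        have "(\<Sum>i<d. v s ^ i * of_real w ^ (d - Suc i)) = (\<Sum>i<d. complex_of_real w ^ (d - 1))"
          by (rule sum.cong) (auto simp: True simp flip: power_add)
        thus ?thesis using True by simp
      next
        case False
        have "(v s - of_real w) * (\<Sum>i<d. of_real w ^ (d - Suc i) * v s ^ i) = 0"
          unfolding power_diff_sumr2[symmetric] by (simp add: v_power)
        thus ?thesis using False by (simp add: mult.commute)
      qed
      have "poly (\<Sum>i<d. monom (t i) (d - Suc i)) w
          = (\<Sum>i<d. \<Sum>s<n. v s ^ i * of_real w ^ (d - Suc i))"
        by (simp add: poly_sum poly_monom t_def sum_distrib_right)
      also have "\<dots> = (\<Sum>s<n. \<Sum>i<d. v s ^ i * of_real w ^ (d - Suc i))"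
        by (rule sum.swap)
      also have "\<dots> = of_nat N * (of_nat d * of_real w ^ (d - 1))"
        unfolding geo by (simp add: sum.If_cases N_def Int_def)
      finally show ?thesis by (simp add: L_def poly_monom)
    qed
    ultimately have "L = 0" using w.small_annihilator_eq_0 by blast
    \<comment> \<open>Only the summand \<open>i = 1\<close> has exponent \<open>d - 2\<close>; the
      subtracted monomial sits at \<open>d - 1\<close>, which differs by \<open>d2\<close>.\<close>
    moreover have "coeff L (d - 2) = t 1"
    proof -
      have "coeff L (d - 2) = (\<Sum>i<d. if i = 1 then t 1 else 0)"
      proof -
        have "coeff (monom (t i) (d - Suc i)) (d - 2) = (if i = 1 then t 1 else 0)" if "i < d" for i
        proof -
          have "d - Suc i = d - 2 \<longleftrightarrow> i = 1" using that d2 by linarith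
          thus ?thesis by auto
        qed
        moreover have "d - 1 \<noteq> d - 2" using d2 by linarith
        ultimately show ?thesis by (simp add: L_def coeff_sum)
      qed
      thus ?thesis using d2 by simp
    qed
    ultimately show False using t1 k(2) n_pos by simp
  qed
  thus ?thesis using k w_def by blast
qed


end

section \<open>Embeddings into the complex numbers\<close>

abbreviation rpoly :: "rat poly \<Rightarrow> complex \<Rightarrow> complex" where
  "rpoly f \<equiv> poly (map_poly of_rat f)"

interpretation of_rat_poly_hom: map_poly_idom_hom "of_rat :: rat \<Rightarrow> complex" ..

text \<open>A total function stands for a map on \<open>F\<close>; for a subfield \<open>F\<close>
  its values outside are arbitrary.\<close>

definition embedding_on :: "complex set \<Rightarrow> (complex \<Rightarrow> complex) \<Rightarrow> bool" where
  "embedding_on F \<phi> \<longleftrightarrow> (\<forall>q. \<phi> (of_rat q) = of_rat q) \<and>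
     (\<forall>a\<in>F. \<forall>b\<in>F. \<phi> (a + b) = \<phi> a + \<phi> b \<and> \<phi> (a * b) = \<phi> a * \<phi> b)"

lemma embedding_on_0: "embedding_on F \<phi> \<Longrightarrow> \<phi> 0 = 0"
  unfolding embedding_on_def by (metis of_rat_0)

lemma embedding_on_1: "embedding_on F \<phi> \<Longrightarrow> \<phi> 1 = 1"
  unfolding embedding_on_def by (metis of_rat_1)

context real_subfield
begin

lemma of_rat_mem: "of_rat q \<in> F"
  using Rats_subset by auto

lemma embedding_sum:
  assumes "embedding_on F \<phi>" "\<And>i. i \<in> I \<Longrightarrow> f i \<in> F"
  shows "\<phi> (sum f I) = (\<Sum>i\<in>I. \<phi> (f i))"
  using assms(2)
proof (induction I rule: infinite_finite_induct)
  case (insert i I)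
  thus ?case using assms(1) sum_mem[of I f] by (simp add: embedding_on_def)
qed (simp_all add: embedding_on_0[OF assms(1)])

lemma embedding_diff:
  assumes "embedding_on F \<phi>" "a \<in> F" "b \<in> F"
  shows "\<phi> (a - b) = \<phi> a - \<phi> b"
proof -
  have "\<phi> ((a - b) + b) = \<phi> (a - b) + \<phi> b"
    using assms diff_mem unfolding embedding_on_def by blast
  thus ?thesis by simp
qed

lemma map_poly_embedding:
  assumes "embedding_on F \<phi>" "p \<in> polys_over F" "q \<in> polys_over F"
  shows "map_poly \<phi> (p + q) = map_poly \<phi> p + map_poly \<phi> q"
    and "map_poly \<phi> (p - q) = map_poly \<phi> p - map_poly \<phi> q"
    and "map_poly \<phi> (p * q) = map_poly \<phi> p * map_poly \<phi> q"
proof -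
  note \<phi> = assms(1) embedding_on_0[OF assms(1)] polys_overD[OF assms(2)] polys_overD[OF assms(3)]
  show "map_poly \<phi> (p + q) = map_poly \<phi> p + map_poly \<phi> q"
    by (rule poly_eqI) (use \<phi> in \<open>simp add: coeff_map_poly embedding_on_def\<close>)
  show "map_poly \<phi> (p - q) = map_poly \<phi> p - map_poly \<phi> q"
    by (rule poly_eqI) (use \<phi> in \<open>simp add: coeff_map_poly embedding_diff\<close>)
  show "map_poly \<phi> (p * q) = map_poly \<phi> p * map_poly \<phi> q"
  proof (rule poly_eqI)
    fix k
    have "\<phi> (coeff (p * q) k) = (\<Sum>i\<le>k. \<phi> (coeff p i * coeff q (k - i)))"
      unfolding coeff_mult by (rule embedding_sum[OF assms(1)]) (intro mult_mem \<phi>)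
    also have "\<dots> = (\<Sum>i\<le>k. \<phi> (coeff p i) * \<phi> (coeff q (k - i)))"
      using \<phi> by (simp add: embedding_on_def)
    finally show "coeff (map_poly \<phi> (p * q)) k = coeff (map_poly \<phi> p * map_poly \<phi> q) k"
      using \<phi> by (simp add: coeff_map_poly coeff_mult)
  qed
qed

text \<open>Membership is carried along in the induction because \<open>\<phi>\<close> respects sums
  and products only inside \<open>F\<close>.\<close>

lemma rpoly_embedding:
  assumes "embedding_on F \<phi>" "z \<in> F"
  shows "rpoly f z \<in> F \<and> \<phi> (rpoly f z) = rpoly f (\<phi> z)"
proof (induction f)
  case 0
  show ?case by (simp add: zero_mem embedding_on_0[OF assms(1)])
next
  case (pCons a f)
  have "of_rat a \<in> F" "z * rpoly f z \<in> F" using pCons assms by (simp_all add: of_rat_mem mult_mem)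
  thus ?case using assms pCons by (auto simp: embedding_on_def map_poly_pCons intro: add_mem)
qed

end

context radical_extension
begin

text \<open>\<open>adjoin F r\<close> is F[X] modulo \<open>radical_poly\<close>, so
  \<open>r\<close> may go to any root of the polynomial that \<open>\<phi>\<close> makes of
  \<open>radical_poly\<close>.\<close>

lemma extend_embedding:
  assumes \<phi>: "embedding_on F \<phi>" and y: "y ^ n = \<phi> (of_real r ^ n)"
  shows "\<exists>\<psi>. embedding_on (adjoin F r) \<psi> \<and> (\<forall>a\<in>F. \<psi> a = \<phi> a) \<and> \<psi> r = y"
proof -
  note \<phi>01 = embedding_on_0[OF \<phi>] embedding_on_1[OF \<phi>]
  have const: "map_poly \<phi> [:a:] = [:\<phi> a:]" for a
    by (rule poly_eqI) (simp add: coeff_map_poly \<phi>01 coeff_pCons split: nat.splits)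
  \<comment> \<open>Well-definedness: two polynomials representing the same element differ by a
    multiple of \<open>radical_poly\<close>, whose image vanishes at \<open>y\<close>.\<close>
  have wd: "poly (map_poly \<phi> p) y = poly (map_poly \<phi> q) y"
    if pq: "p \<in> polys_over F" "q \<in> polys_over F" and eq: "poly p r = poly q r" for p q
  proof -
    have "p - q \<in> polys_over F" "poly (p - q) r = 0"
      using pq eq by (auto intro: polys_over_simps)
    then obtain u where u: "u \<in> polys_over F" "p - q = radical_poly * u" by (rule annihilator)
    have "map_poly \<phi> radical_poly = monom 1 n - [:\<phi> (of_real r ^ n):]"
    proof -
      have "map_poly \<phi> (monom 1 n) = monom 1 n"
        by (rule poly_eqI) (simp add: coeff_map_poly \<phi>01)
      thus ?thesis unfolding radical_poly_def const[symmetric]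
        by (subst map_poly_embedding(2)[OF \<phi>]) (auto intro!: polys_over_simps one_mem power_in)
    qed
    hence "poly (map_poly \<phi> radical_poly) y = 0" using y by (simp add: poly_monom)
    hence "poly (map_poly \<phi> (p - q)) y = 0"
      unfolding u(2) map_poly_embedding(3)[OF \<phi> radical_poly(1) u(1)] by simp
    thus ?thesis by (simp add: map_poly_embedding(2)[OF \<phi> pq])
  qed
  define \<psi> where "\<psi> a = poly (map_poly \<phi> (SOME p. p \<in> polys_over F \<and> poly p r = a)) y" for a
  have \<psi>: "\<psi> (poly p r) = poly (map_poly \<phi> p) y" if "p \<in> polys_over F" for p
  proof -
    have "(SOME q. q \<in> polys_over F \<and> poly q r = poly p r) \<in> polys_over F \<and>
        poly (SOME q. q \<in> polys_over F \<and> poly q r = poly p r) r = poly p r"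
      by (rule someI[of _ p]) (use that in simp)
    thus ?thesis unfolding \<psi>_def using wd that by blast
  qed
  have on_F: "\<psi> a = \<phi> a" if "a \<in> F" for a
    using \<psi>[of "[:a:]"] that by (simp add: polys_over_simps const)
  have "\<psi> (a + b) = \<psi> a + \<psi> b \<and> \<psi> (a * b) = \<psi> a * \<psi> b"
    if "a \<in> adjoin F r" "b \<in> adjoin F r" for a b
  proof -
    obtain p q where pq: "p \<in> polys_over F" "a = poly p r" "q \<in> polys_over F" "b = poly q r"
      using \<open>a \<in> adjoin F r\<close> \<open>b \<in> adjoin F r\<close> by (meson adjoinE)
    show ?thesis
      using \<psi>[of "p + q"] \<psi>[of "p * q"] \<psi>[of p] \<psi>[of q] pq
      by (simp add: polys_over_simps map_poly_embedding[OF \<phi>])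
  qed
  moreover have "\<psi> (of_rat q) = of_rat q" for q
    using on_F[OF of_rat_mem] \<phi> by (simp add: embedding_on_def)
  ultimately have "embedding_on (adjoin F r) \<psi>" by (simp add: embedding_on_def)
  moreover have "\<psi> r = y"
    using \<psi>[of "[:0, 1:]"] by (simp add: polys_over_simps zero_mem one_mem map_poly_pCons \<phi>01)
  ultimately show ?thesis using on_F by blast
qed

end

section \<open>The tower of radicals\<close>

lemma real_subfield_Rats: "real_subfield \<rat>"
  by unfold_locales (auto elim!: Rats_cases')

text \<open>The cross-multiplied form of X/Y = (a/b)^n with both fractions in lowest terms, so the
  numerators agree.\<close>

lemma coprime_power_fraction:
  fixes X Y a b :: nat
  assumes "X * b ^ n = a ^ n * Y" "coprime a b" "coprime X Y"
  shows "X = a ^ n"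
proof (rule dvd_antisym)
  have "a ^ n dvd X * b ^ n" using assms(1) by simp
  moreover have "coprime (a ^ n) (b ^ n)" using assms(2) by simp
  ultimately show "a ^ n dvd X" by (simp add: coprime_dvd_mult_left_iff)
  have "X dvd a ^ n * Y" using assms(1) by (metis dvd_triv_left)
  thus "X dvd a ^ n" using assms(3) by (simp add: coprime_dvd_mult_left_iff)
qed

text \<open>Each level consists of polynomial expressions only; that the levels are fields is part
  of \<open>tower_subfield_radicals\<close>.\<close>

primrec tower :: "(nat \<Rightarrow> real) \<Rightarrow> nat \<Rightarrow> complex set" where
  "tower \<rho> 0 = \<rat>"
| "tower \<rho> (Suc j) = adjoin (tower \<rho> j) (complex_of_real (\<rho> (Suc j)))"

locale coprime_radicands =
  fixes n m :: nat and \<epsilon> :: complex and x :: "nat \<Rightarrow> nat"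
  assumes n: "n \<ge> 2" and \<epsilon>: "primitive_unity_root n \<epsilon>"
    and x_pos: "\<And>j. j \<in> {1..m} \<Longrightarrow> x j > 0"
    and x_coprime: "\<And>i j. i \<in> {1..m} \<Longrightarrow> j \<in> {1..m} \<Longrightarrow> i \<noteq> j \<Longrightarrow> coprime (x i) (x j)"
    and irrational: "\<And>j k. j \<in> {1..m} \<Longrightarrow> 0 < k \<Longrightarrow> k < n \<Longrightarrow> root n (real (x j)) ^ k \<notin> \<rat>"
begin

definition \<rho> :: "nat \<Rightarrow> real" where "\<rho> j = root n (real (x j))"

lemma \<rho>_pos: "j \<in> {1..m} \<Longrightarrow> \<rho> j > 0"
  using n x_pos by (simp add: \<rho>_def)

lemma \<rho>_power: "\<rho> j ^ n = real (x j)"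
  using n by (simp add: \<rho>_def)

text \<open>Taking \<open>n\<close>-th powers turns the monomial into a product \<open>Y\<close> of
  earlier radicands, coprime to \<open>x (Suc j)\<close>. Comparing reduced fractions,
  \<open>x (Suc j) ^ k\<close> is an \<open>n\<close>-th power of a natural number, against
  \<open>irrational\<close>.\<close>

lemma radical_not_monomial:
  assumes j: "Suc j \<le> m" and k: "0 < k" "k < n"
    and eq: "\<rho> (Suc j) ^ k = q * (\<Prod>i=1..j. \<rho> i ^ e i)" and q: "q \<in> \<rat>"
  shows False
proof -
  have \<rho>: "\<rho> (Suc j) > 0" using \<rho>_pos j by simp
  obtain a b :: nat where ab: "b \<noteq> 0" "\<bar>q\<bar> = real a / real b" "coprime a b"
    using q by (rule Rats_abs_nat_div_natE)
  define Y where "Y = (\<Prod>i=1..j. x i ^ e i)"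
  have "(\<Prod>i=1..j. \<rho> i ^ e i) ^ n = (\<Prod>i=1..j. (\<rho> i ^ n) ^ e i)"
    by (simp add: prod_power_distrib mult.commute flip: power_mult)
  hence Y: "(\<Prod>i=1..j. \<rho> i ^ e i) ^ n = real Y" by (simp add: \<rho>_power Y_def)
  have pos: "(\<Prod>i=1..j. \<rho> i ^ e i) > 0"
    by (intro prod_pos zero_less_power \<rho>_pos) (use j in auto)
  have "q > 0"
    using \<rho> eq pos by (metis zero_less_mult_pos2 zero_less_power)
  hence q': "q = real a / real b" using ab by simp
  have "real (x (Suc j)) ^ k = (\<rho> (Suc j) ^ k) ^ n"
    by (simp add: mult.commute flip: \<rho>_power power_mult)
  also have "\<dots> = (real a / real b) ^ n * real Y"
    unfolding eq power_mult_distrib Y q' ..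
  finally have "real (x (Suc j) ^ k * b ^ n) = real (a ^ n * Y)"
    using ab by (simp add: power_divide field_simps)
  hence "x (Suc j) ^ k * b ^ n = a ^ n * Y" by (simp only: of_nat_eq_iff)
  moreover have "coprime (x (Suc j) ^ k) Y"
    unfolding Y_def by (intro prod_coprime_right) (use j x_coprime in auto)
  ultimately have "x (Suc j) ^ k = a ^ n" using ab coprime_power_fraction by blast
  hence "(\<rho> (Suc j) ^ k) ^ n = real a ^ n"
    by (metis \<rho>_power mult.commute of_nat_power power_mult)
  hence "\<rho> (Suc j) ^ k = real a"
    using power_eq_imp_eq_base[of "\<rho> (Suc j) ^ k" n "real a"] \<rho> n by simp
  thus False using irrational[of "Suc j" k] j k by (simp add: \<rho>_def)
qed

text \<open>A power of the new radical inside the tower would be a positive element with rational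
  \<open>n\<close>-th power, hence a monomial. The hypothesis \<open>radicals\<close> is the
  induction hypothesis of \<open>tower_subfield_radicals\<close>.\<close>

lemma radical_extension_tower:
  assumes "Suc j \<le> m" "real_subfield (tower \<rho> j)"
    and radicals: "\<And>b::real. b > 0 \<Longrightarrow> complex_of_real b \<in> tower \<rho> j \<Longrightarrow> b ^ n \<in> \<rat> \<Longrightarrow>
           \<exists>q\<in>\<rat>. \<exists>e. b = q * (\<Prod>i=1..j. \<rho> i ^ e i)"
  shows "radical_extension (tower \<rho> j) (\<rho> (Suc j)) n"
proof -
  interpret real_subfield "tower \<rho> j" by fact
  show ?thesis
  proof
    show \<rho>: "\<rho> (Suc j) > 0" using \<rho>_pos assms by simp
    show "0 < n" using n by simp
    show "complex_of_real (\<rho> (Suc j)) ^ n \<in> tower \<rho> j"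
      using of_nat_mem[of "x (Suc j)"] by (simp add: \<rho>_power flip: of_real_power)
    fix k :: nat assume k: "0 < k" "k < n"
    show "complex_of_real (\<rho> (Suc j)) ^ k \<notin> tower \<rho> j"
    proof
      assume mem: "complex_of_real (\<rho> (Suc j)) ^ k \<in> tower \<rho> j"
      have "(\<rho> (Suc j) ^ k) ^ n = real (x (Suc j)) ^ k"
        by (simp add: mult.commute flip: \<rho>_power power_mult)
      hence "(\<rho> (Suc j) ^ k) ^ n \<in> \<rat>" by simp
      thus False using radicals[of "\<rho> (Suc j) ^ k"] mem \<rho> radical_not_monomial[OF assms(1) k] by auto
    qed
  qed
qed

text \<open>Both claims go through one induction: the description of radicals at level
  \<open>j\<close> makes the next step a radical extension, and \<open>radical_in_adjoin\<close>
  then splits a power of \<open>\<rho> (Suc j)\<close> off any radical of the next level.\<close>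

lemma tower_subfield_radicals:
  assumes "j \<le> m"
  shows "real_subfield (tower \<rho> j) \<and>
    (\<forall>b::real. b > 0 \<longrightarrow> complex_of_real b \<in> tower \<rho> j \<longrightarrow> b ^ n \<in> \<rat> \<longrightarrow>
      (\<exists>q\<in>\<rat>. \<exists>e. b = q * (\<Prod>i=1..j. \<rho> i ^ e i)))"
  using assms
proof (induction j)
  case 0
  show ?case using real_subfield_Rats by simp
next
  case (Suc j)
  hence IH: "real_subfield (tower \<rho> j)" "\<And>b::real. b > 0 \<Longrightarrow> complex_of_real b \<in> tower \<rho> j \<Longrightarrow>
      b ^ n \<in> \<rat> \<Longrightarrow> \<exists>q\<in>\<rat>. \<exists>e. b = q * (\<Prod>i=1..j. \<rho> i ^ e i)"
    by simp_all
  interpret radical_extension "tower \<rho> j" "\<rho> (Suc j)" n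
    by (rule radical_extension_tower[OF Suc.prems IH])
  have "\<exists>q\<in>\<rat>. \<exists>e. b = q * (\<Prod>i=1..Suc j. \<rho> i ^ e i)"
    if b: "b > 0" "complex_of_real b \<in> tower \<rho> (Suc j)" "b ^ n \<in> \<rat>" for b :: real
  proof -
    have "complex_of_real (b ^ n) \<in> \<rat>" using b(3) by (simp only: Rats_complex_of_real_iff)
    hence "complex_of_real b ^ n \<in> tower \<rho> j" using Rats_subset by auto
    then obtain k where k: "complex_of_real (b / \<rho> (Suc j) ^ k) \<in> tower \<rho> j"
      using radical_in_adjoin[OF \<epsilon>] b by auto
    have "(b / \<rho> (Suc j) ^ k) ^ n = b ^ n / real (x (Suc j)) ^ k"
      by (simp add: power_divide mult.commute flip: \<rho>_power power_mult)
    hence "(b / \<rho> (Suc j) ^ k) ^ n \<in> \<rat>" using b by simp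
    then obtain q e where q: "q \<in> \<rat>" "b / \<rho> (Suc j) ^ k = q * (\<Prod>i=1..j. \<rho> i ^ e i)"
      using IH(2)[OF _ k] b(1) r_pos by auto
    have "b = q * (\<Prod>i=1..Suc j. \<rho> i ^ (e(Suc j := k)) i)"
      using q(2) r_pos by (simp add: field_simps)
    thus ?thesis using q(1) by blast
  qed
  thus ?case using adjoin_subfield by simp
qed

lemma tower_subfield: "j \<le> m \<Longrightarrow> real_subfield (tower \<rho> j)"
  using tower_subfield_radicals by blast

section \<open>Embeddings of the tower and conjugates of the sum of radicals\<close>

lemma tower_embedding:
  assumes "j \<le> m"
  shows "\<exists>\<phi>. embedding_on (tower \<rho> j) \<phi> \<and>
    (\<forall>i\<in>{1..j}. of_real (\<rho> i) \<in> tower \<rho> j \<and> \<phi> (of_real (\<rho> i)) = \<epsilon> ^ s i * of_real (\<rho> i))"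
  using assms
proof (induction j)
  case 0
  have "embedding_on \<rat> (\<lambda>z. z)" by (simp add: embedding_on_def)
  thus ?case by auto
next
  case (Suc j)
  then obtain \<phi> where \<phi>: "embedding_on (tower \<rho> j) \<phi>"
    "\<And>i. i \<in> {1..j} \<Longrightarrow> of_real (\<rho> i) \<in> tower \<rho> j"
    "\<And>i. i \<in> {1..j} \<Longrightarrow> \<phi> (of_real (\<rho> i)) = \<epsilon> ^ s i * of_real (\<rho> i)" by auto
  interpret radical_extension "tower \<rho> j" "\<rho> (Suc j)" n
    by (rule radical_extension_tower[OF Suc.prems]) (use tower_subfield_radicals[of j] Suc.prems in auto)
  \<comment> \<open>The radicand is rational and hence fixed by \<open>\<phi>\<close>, so every
    multiple of \<open>\<rho> (Suc j)\<close> by a power of \<open>\<epsilon>\<close> is an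
    admissible image.\<close>
  have "(\<epsilon> ^ s (Suc j)) ^ n = 1"
    using \<epsilon> by (metis mult.commute power_mult power_one primitive_unity_root_def)
  moreover have "complex_of_real (\<rho> (Suc j)) ^ n = of_rat (of_nat (x (Suc j)))"
    by (simp add: \<rho>_power flip: of_real_power)
  moreover from this have "\<phi> (complex_of_real (\<rho> (Suc j)) ^ n) = complex_of_real (\<rho> (Suc j)) ^ n"
    using \<phi>(1) unfolding embedding_on_def by metis
  ultimately obtain \<psi> where \<psi>: "embedding_on (tower \<rho> (Suc j)) \<psi>"
    "\<And>a. a \<in> tower \<rho> j \<Longrightarrow> \<psi> a = \<phi> a"
    "\<psi> (\<rho> (Suc j)) = \<epsilon> ^ s (Suc j) * of_real (\<rho> (Suc j))"
    using extend_embedding[OF \<phi>(1), of "\<epsilon> ^ s (Suc j) * of_real (\<rho> (Suc j))"]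
    by (auto simp: power_mult_distrib)
  have "of_real (\<rho> i) \<in> tower \<rho> (Suc j) \<and> \<psi> (of_real (\<rho> i)) = \<epsilon> ^ s i * of_real (\<rho> i)"
    if "i \<in> {1..Suc j}" for i
  proof (cases "i = Suc j")
    case True
    thus ?thesis using \<psi>(3) gen_mem_adjoin by simp
  next
    case False
    hence "i \<in> {1..j}" using that by auto
    thus ?thesis using \<phi>(2,3)[of i] \<psi>(2)[of "of_real (\<rho> i)"] subsetD[OF subset_adjoin] by simp
  qed
  thus ?case using \<psi>(1) by blast
qed

text \<open>The factors of \<open>root_product\<close> are \<open>t + conjugate s\<close>.\<close>

definition conjugate :: "(nat \<Rightarrow> nat) \<Rightarrow> complex" where
  "conjugate s = (\<Sum>j=1..m. \<epsilon> ^ s j * of_real (\<rho> j))"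

text \<open>The embedding with exponents \<open>s\<close> fixes the coefficients of \<open>f\<close>
  and maps the sum of the radicals to \<open>conjugate s\<close>.\<close>

lemma rpoly_conjugate:
  assumes "rpoly f ((- (\<Sum>j=1..m. complex_of_real (\<rho> j))) ^ n) = 0"
  shows "rpoly f ((- conjugate s) ^ n) = 0"
proof -
  interpret real_subfield "tower \<rho> m" by (rule tower_subfield) simp
  obtain \<phi> where \<phi>: "embedding_on (tower \<rho> m) \<phi>"
    "\<And>j. j \<in> {1..m} \<Longrightarrow> of_real (\<rho> j) \<in> tower \<rho> m"
    "\<And>j. j \<in> {1..m} \<Longrightarrow> \<phi> (of_real (\<rho> j)) = \<epsilon> ^ s j * of_real (\<rho> j)"
    using tower_embedding[OF order_refl, of s] by auto
  define \<alpha> where "\<alpha> = (\<Sum>j=1..m. complex_of_real (\<rho> j))"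
  have \<alpha>: "\<alpha> \<in> tower \<rho> m" unfolding \<alpha>_def using \<phi>(2) by (rule sum_mem)
  have "\<phi> \<alpha> = conjugate s"
    unfolding \<alpha>_def conjugate_def using embedding_sum[OF \<phi>(1), of "{1..m}" "\<lambda>j. of_real (\<rho> j)"] \<phi>(2,3)
    by simp
  hence neg: "\<phi> (- \<alpha>) = - conjugate s"
    using embedding_diff[OF \<phi>(1) zero_mem \<alpha>] embedding_on_0[OF \<phi>(1)] by simp
  have m\<alpha>: "- \<alpha> \<in> tower \<rho> m" using \<alpha> by (rule uminus_mem)
  have "\<phi> ((- \<alpha>) ^ k) = (- conjugate s) ^ k" for k
  proof (induction k)
    case 0
    show ?case by (simp add: embedding_on_1[OF \<phi>(1)])
  next
    case (Suc k)
    have "\<phi> (- \<alpha> * (- \<alpha>) ^ k) = \<phi> (- \<alpha>) * \<phi> ((- \<alpha>) ^ k)"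
      using \<phi>(1) m\<alpha> power_mem[OF m\<alpha>, of k] unfolding embedding_on_def by blast
    thus ?case unfolding power_Suc neg Suc.IH .
  qed
  hence "rpoly f ((- conjugate s) ^ n) = \<phi> (rpoly f ((- \<alpha>) ^ n))"
    using rpoly_embedding[OF \<phi>(1) power_mem[OF m\<alpha>]] by simp
  thus ?thesis using assms embedding_on_0[OF \<phi>(1)] by (simp add: \<alpha>_def)
qed

text \<open>Each summand has real part at most \<open>\<rho> i\<close>, so equality of the sums
  forces equality in every term; a number of modulus 1 with real part 1 is 1.\<close>

lemma conjugate_eq_sum_imp:
  assumes "conjugate s = (\<Sum>j=1..m. complex_of_real (\<rho> j))" "j \<in> {1..m}"
  shows "\<epsilon> ^ s j = 1"
proof -
  have \<epsilon>1: "norm (\<epsilon> ^ k) = 1" for k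
  proof -
    have "norm \<epsilon> ^ n = 1"
      using \<epsilon> by (metis norm_one norm_power primitive_unity_root_def)
    hence "norm \<epsilon> = 1" using n power_eq_imp_eq_base[of "norm \<epsilon>" n 1] by simp
    thus ?thesis by (simp add: norm_power)
  qed
  have le: "Re (\<epsilon> ^ s i) * \<rho> i \<le> \<rho> i" if "i \<in> {1..m}" for i
    using \<rho>_pos[OF that] complex_Re_le_cmod[of "\<epsilon> ^ s i"] by (simp add: \<epsilon>1)
  have "(\<Sum>i=1..m. Re (\<epsilon> ^ s i) * \<rho> i) = (\<Sum>i=1..m. \<rho> i)"
    using arg_cong[OF assms(1), of Re] by (simp add: conjugate_def)
  hence "(\<Sum>i=1..m. \<rho> i - Re (\<epsilon> ^ s i) * \<rho> i) = 0" by (simp add: sum_subtractf)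
  hence "\<rho> j - Re (\<epsilon> ^ s j) * \<rho> j = 0"
    using le assms(2) by (subst (asm) sum_nonneg_eq_0_iff) auto
  hence "Re (\<epsilon> ^ s j) = 1" using \<rho>_pos[OF assms(2)] by simp
  moreover have "Im (\<epsilon> ^ s j) = 0"
    using \<epsilon>1[of "s j"] calculation cmod_power2[of "\<epsilon> ^ s j"] by simp
  ultimately show ?thesis by (simp add: complex_eq_iff)
qed

end

section \<open>Irreducibility from a simple root\<close>

text \<open>Let \<open>g\<close> and \<open>h\<close> be annihilators of least degree of
  \<open>z\<close> and \<open>w\<close>. By \<open>tr\<close>, \<open>h\<close> is a multiple of
  \<open>g\<close>; were g(w) nonzero, the cofactor would annihilate \<open>w\<close> with smaller
  degree. So g(w) = 0, and \<open>g\<close> divides \<open>b\<close>.\<close>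

lemma rational_conjugates_sym:
  assumes f: "f \<noteq> 0" "rpoly f w = 0" and tr: "\<And>h. rpoly h w = 0 \<Longrightarrow> rpoly h z = 0"
    and b: "rpoly b z = 0"
  shows "rpoly b w = 0"
proof -
  define P where "P h \<longleftrightarrow> h \<noteq> 0 \<and> rpoly h z = 0" for h
  have "P f" using f tr by (simp add: P_def)
  then obtain g where g: "P g" and min: "\<And>h. P h \<Longrightarrow> degree g \<le> degree h"
    using ex_has_least_nat[of P f degree] by blast
  have dvd: "g dvd h" if "rpoly h z = 0" for h
  proof -
    have "rpoly (g * (h div g) + h mod g) z = 0" using that by simp
    hence "rpoly (h mod g) z = 0"
      using g unfolding of_rat_poly_hom.hom_add of_rat_poly_hom.hom_mult by (simp add: P_def)
    hence "h mod g = 0"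
      using min[of "h mod g"] degree_mod_less[of g h] g by (auto simp: P_def)
    thus ?thesis by (simp add: mod_eq_0_iff_dvd)
  qed
  have "\<exists>h. h \<noteq> 0 \<and> rpoly h w = 0" using f by blast
  then obtain h where h: "h \<noteq> 0" "rpoly h w = 0"
    and hmin: "\<And>h'. h' \<noteq> 0 \<Longrightarrow> rpoly h' w = 0 \<Longrightarrow> degree h \<le> degree h'"
    using ex_has_least_nat[of "\<lambda>h. h \<noteq> 0 \<and> rpoly h w = 0" f degree] f by blast
  obtain q where q: "h = g * q" using dvd[OF tr[OF h(2)]] by (rule dvdE)
  have "rpoly g w = 0"
  proof (rule ccontr)
    assume "rpoly g w \<noteq> 0"
    hence "rpoly q w = 0" using h(2) by (simp add: q of_rat_poly_hom.hom_mult)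
    moreover have nz: "q \<noteq> 0" "g \<noteq> 0" using h q by auto
    ultimately have "degree h \<le> degree q" using hmin by blast
    hence "degree g = 0" using nz by (simp add: q degree_mult_eq)
    then obtain c where "g = [:c:]" by (rule degree_eq_zeroE)
    thus False using g by (auto simp: P_def map_poly_pCons)
  qed
  thus ?thesis using dvd[OF b] by (auto simp: of_rat_poly_hom.hom_mult elim!: dvdE)
qed

text \<open>Simplicity of \<open>w\<close> is expressed through factorizations. One factor vanishes
  at \<open>w\<close>; a root of the other would be conjugate to \<open>w\<close>, making
  \<open>w\<close> a root of both.\<close>

lemma irreducible_if_simple_root:
  fixes p :: "rat poly"
  assumes p: "p \<noteq> 0" "rpoly p w = 0"
    and simple: "\<And>a b. p = a * b \<Longrightarrow> rpoly a w = 0 \<Longrightarrow> rpoly b w \<noteq> 0"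
    and tr: "\<And>h z. rpoly h w = 0 \<Longrightarrow> rpoly p z = 0 \<Longrightarrow> rpoly h z = 0"
  shows "Factorial_Ring.irreducible p"
proof (rule irreducibleI)
  show "p \<noteq> 0" by fact
  show "\<not> is_unit p"
  proof
    assume "is_unit p"
    hence "degree p = 0" using p by (simp add: is_unit_iff_degree)
    then obtain c where "p = [:c:]" by (rule degree_eq_zeroE)
    thus False using p by (simp add: map_poly_pCons)
  qed
  have unit: "is_unit b" if ab: "p = a * b" "rpoly a w = 0" for a b
  proof (rule ccontr)
    assume "\<not> is_unit b"
    moreover have "b \<noteq> 0" using p ab by auto
    ultimately have "degree b \<noteq> 0" by (auto simp: is_unit_iff_degree)
    hence "\<not> constant (rpoly b)" by (simp add: constant_degree)
    then obtain z where z: "rpoly b z = 0" using fundamental_theorem_of_algebra by blast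
    hence "rpoly p z = 0" by (simp add: ab of_rat_poly_hom.hom_mult)
    hence "rpoly b w = 0" using rational_conjugates_sym[OF p] tr z by blast
    thus False using simple[OF ab] by simp
  qed
  fix a b assume ab: "p = a * b"
  hence "rpoly a w = 0 \<or> rpoly b w = 0" using p(2) by (simp add: of_rat_poly_hom.hom_mult)
  thus "is_unit a \<or> is_unit b" using unit[of a b] unit[of b a] ab by (auto simp: mult.commute)
qed

section \<open>The roots of \<open>p_poly\<close> and the simplicity of one of them\<close>

theorem corollary7p1:
  fixes n m :: nat and \<epsilon> :: complex and x :: "nat \<Rightarrow> nat"
  assumes "n \<ge> 2" and "m \<ge> 1"
    and "primitive_unity_root n \<epsilon>"
    and "\<And>j. j \<in> {1..m} \<Longrightarrow> x j > 0"
    and "\<And>i j. i \<in> {1..m} \<Longrightarrow> j \<in> {1..m} \<Longrightarrow> i \<noteq> j \<Longrightarrow> coprime (x i) (x j)"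
    and "\<And>j k. j \<in> {1..m} \<Longrightarrow> 0 < k \<Longrightarrow> k < n \<Longrightarrow> root n (real (x j)) ^ k \<notin> \<rat>"
  shows "Factorial_Ring.irreducible (map_poly of_int (p_poly n \<epsilon> m x) :: rat poly)"
proof -
  interpret coprime_radicands n m \<epsilon> x by unfold_locales (use assms in auto)
  let ?S = "{1..m} \<rightarrow>\<^sub>E {1..n}"
  define p where "p = (map_poly of_int (p_poly n \<epsilon> m x) :: rat poly)"
  define \<alpha> where "\<alpha> = (\<Sum>j=1..m. complex_of_real (\<rho> j))"
  have fin: "finite ?S" by (rule finite_PiE) simp_all
  have "map_poly of_rat p = (map_poly of_int (p_poly n \<epsilon> m x) :: complex poly)"
    unfolding p_def by (rule poly_eqI) (simp add: coeff_map_poly)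
  hence p_eval: "rpoly p (t ^ n) = (\<Prod>s\<in>?S. t + conjugate s)" for t
    using p_poly_eq[of n m \<epsilon> x t] assms
    by (simp add: root_product_def conjugate_def \<rho>_def)
  \<comment> \<open>The trivial root of unity has exponent \<open>n\<close> and not 0, since the
    tuples have entries in \<open>{1..n}\<close>; \<open>restrict\<close> puts \<open>s0\<close>
    into the extensional function space.\<close>
  define s0 where "s0 = restrict (\<lambda>_. n) {1..m}"
  have s0: "s0 \<in> ?S" using assms(1) by (auto simp: s0_def)
  have "\<epsilon> ^ n = 1" using assms(3) by (simp add: primitive_unity_root_def)
  hence conj_s0: "conjugate s0 = \<alpha>"
    unfolding conjugate_def \<alpha>_def by (intro sum.cong) (auto simp: s0_def)
  have unique: "s = s0" if "s \<in> ?S" "conjugate s = \<alpha>" for s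
  proof (rule PiE_ext[OF that(1) s0])
    fix j assume j: "j \<in> {1..m}"
    have "\<epsilon> ^ s j = 1" using conjugate_eq_sum_imp j that(2) unfolding \<alpha>_def by blast
    moreover have "s j \<in> {1..n}" using that(1) j by auto
    ultimately show "s j = s0 j"
      using assms(3) j by (auto simp: primitive_unity_root_def s0_def) (meson le_neq_implies_less less_eq_Suc_le)
  qed
  have root: "rpoly p ((- \<alpha>) ^ n) = 0"
    unfolding p_eval using fin s0 conj_s0 by (auto simp: prod_zero_iff intro!: bexI[of _ s0])
  have p0: "p \<noteq> 0"
  proof
    assume "p = 0"
    \<comment> \<open>Otherwise every complex number would be among the finitely many zeros of the
      product.\<close>
    hence "(\<Prod>s\<in>?S. t + conjugate s) = 0" for t using p_eval[of t] by simp
    hence "\<exists>s\<in>?S. t = - conjugate s" for t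
      using fin by (simp add: prod_zero_iff add_eq_0_iff2)
    hence "UNIV \<subseteq> (\<lambda>s. - conjugate s) ` ?S" by blast
    hence "finite (UNIV :: complex set)" using fin finite_surj by blast
    thus False by (simp add: infinite_UNIV_char_0)
  qed
  have "Factorial_Ring.irreducible p"
  proof (rule irreducible_if_simple_root[OF p0 root])
    fix a b assume ab: "p = a * b" "rpoly a ((- \<alpha>) ^ n) = 0"
    show "rpoly b ((- \<alpha>) ^ n) \<noteq> 0"
    proof
      assume b: "rpoly b ((- \<alpha>) ^ n) = 0"
      \<comment> \<open>Substituting X^n for z brings both factors to the variable of
        \<open>root_product\<close>, where the linear factors are explicit. A common zero then gives
        two factors X + \<alpha>.\<close>
      define A where "A = map_poly of_rat a \<circ>\<^sub>p (monom 1 n :: complex poly)"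
      define B where "B = map_poly of_rat b \<circ>\<^sub>p (monom 1 n :: complex poly)"
      have "poly A (- \<alpha>) = 0" "poly B (- \<alpha>) = 0"
        using ab(2) b by (simp_all add: A_def B_def poly_pcompose poly_monom)
      then obtain A' B' where AB: "A = [:\<alpha>, 1:] * A'" "B = [:\<alpha>, 1:] * B'"
        by (auto simp: poly_eq_0_iff_dvd elim!: dvdE)
      have "poly (A * B) = poly (\<Prod>s\<in>?S. [:conjugate s, 1:])"
      proof
        fix t
        have "poly (A * B) t = rpoly p (t ^ n)"
          by (simp add: A_def B_def poly_pcompose poly_monom ab(1) of_rat_poly_hom.hom_mult)
        thus "poly (A * B) t = poly (\<Prod>s\<in>?S. [:conjugate s, 1:]) t"
          by (simp add: p_eval poly_prod add.commute)
      qed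
      hence "A * B = (\<Prod>s\<in>?S. [:conjugate s, 1:])" by (simp only: poly_eq_poly_eq_iff)
      also have "\<dots> = [:\<alpha>, 1:] * (\<Prod>s\<in>?S - {s0}. [:conjugate s, 1:])"
        using prod.remove[OF fin s0, of "\<lambda>s. [:conjugate s, 1:]"] conj_s0 by simp
      finally have "[:\<alpha>, 1:] * (A' * B) = [:\<alpha>, 1:] * (\<Prod>s\<in>?S - {s0}. [:conjugate s, 1:])"
        by (simp only: AB mult.assoc)
      hence "A' * B = (\<Prod>s\<in>?S - {s0}. [:conjugate s, 1:])"
        by (simp only: mult_cancel_left pCons_eq_0_iff) simp
      \<comment> \<open>One factor X + \<alpha> is cancelled against \<open>s0\<close>; the zero of
        \<open>B\<close> makes a second conjugate equal to \<alpha>.\<close>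
      hence "poly (\<Prod>s\<in>?S - {s0}. [:conjugate s, 1:]) (- \<alpha>) = 0"
        using \<open>poly B (- \<alpha>) = 0\<close> by (metis mult_zero_right poly_mult)
      hence "\<exists>s\<in>?S - {s0}. conjugate s = \<alpha>"
        using fin by (simp add: poly_prod prod_zero_iff)
      thus False using unique by blast
    qed
  next
    fix h z assume h: "rpoly h ((- \<alpha>) ^ n) = 0" and z: "rpoly p z = 0"
    \<comment> \<open>An \<open>n\<close>-th root of \<open>z\<close> from its polar form, as
      \<open>p_eval\<close> describes \<open>p\<close> only at \<open>n\<close>-th powers.\<close>
    obtain t where t: "t ^ n = z"
      using DeMoivre2 rcis_cmod_Arg[of z] that[of "rcis (root n (cmod z)) (Arg z / n)"] assms(1)
      by simp
    then obtain s where "t = - conjugate s"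
      using z p_eval[of t] fin by (auto simp: prod_zero_iff add_eq_0_iff2)
    thus "rpoly h z = 0" using rpoly_conjugate[of h s] h t by (simp add: \<alpha>_def)
  qed
  thus ?thesis by (simp add: p_def)
qed

end
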